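(* Suppose that $K\ge 31$. Then the numbers $D_{i,K}$ of pairs of consecutive roots at distance $i$ in the ballistic deposition process on the cyclic strip $[K]$ satisfy $$E(D_{2,K})=\frac{K}{9},\quad E(D_{3,K})=\frac{2K}{35},\quad E(D_{4,K})=\frac{K}{45},\quad E(D_{5,K})=\frac{4K}{567},\quad E(D_{6,K})=\frac{K}{525},\quad E(D_{7,K})=\frac{2K}{4455},$$ and $$\sigma^2(D_{2,K})=\frac{32K}{405},\quad \sigma^2(D_{3,K})=\frac{119732K}{2837835},\quad \sigma^2(D_{4,K})=\frac{12154K}{637875},$$ $$\sigma^2(D_{5,K})=\frac{649555688K}{97692469875},\quad \sigma^2(D_{6,K})=\frac{5967328K}{3192564375},\quad \sigma^2(D_{7,K})=\frac{191501338988K}{428772250281375}.$$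
   Context: Ballistic deposition on a strip: for an integer $K\ge 3$ let $[K]=\{1,\dots,K\}$, and define the (cyclic) neighbour sets $I(1)=\{K,1,2\}$, $I(k)=\{k-1,k,k+1\}$ for $2\le k\le K-1$, and $I(K)=\{K-1,K,1\}$. Let $(X_n)_{n\ge 0}$ be i.i.d. random variables uniformly distributed on $[K]$. Define random height functions $H_n:[K]\to\{0,1,2,\dots\}$ by $H_0(k)=0$ for all $k\in[K]$ and, for $n\ge 1$, $H_n(k)=H_{n-1}(k)$ if $X_n\ne k$, and $H_n(k)=\max_{j\in I(k)}H_{n-1}(j)+1$ if $X_n=k$. The set of roots eventually formed is $\mathcal R^{[K]}=\{k\in[K]: H_i(k)=1 \text{ for some } i\ge 1\}$, and $R^{[K]}=\mathrm{Card}(\mathcal R^{[K]})$. Let $r_1<\cdots<r_{R^{[K]}}$ be the ordered locations of the roots. For $1\le i\le K-1$ let $D_{i,K}=\sum_{j=1}^{R^{[K]}-1}\mathbf 1_{\{r_{j+1}-r_j=i+1\}}+\mathbf 1_{\{r_{R^{[K]}}-r_1=K-i-1\}}$ be the number of pairs of (cyclically) consecutive roots with distance $i$ (that is, $i$ non-root sites) between them. $E(X)$ and $\sigma^2(X)$ denote the mean and variance of a random variable $X$. *)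

theory Defs
  imports "HOL-Probability.Probability"
begin

text \<open>
  Ballistic deposition on the cyclic strip \<open>{1..K}\<close>. The height function, the roots and
  the gap counts are defined for a deterministic sequence \<open>x\<close> of deposition sites; the
  random objects arise by inserting the sample path \<open>\<lambda>n. X n \<omega>\<close>.
\<close>

definition nbrs :: "nat \<Rightarrow> nat \<Rightarrow> nat set" where
  "nbrs K k = (if k = 1 then {K, 1, 2} else if k = K then {K - 1, K, 1} else {k - 1, k, k + 1})"

text \<open>The first deposition is at site \<open>x 1\<close>; the value \<open>x 0\<close> is not used.\<close>

primrec height :: "nat \<Rightarrow> (nat \<Rightarrow> nat) \<Rightarrow> nat \<Rightarrow> nat \<Rightarrow> nat" where
  "height K x 0 = (\<lambda>k. 0)"
| "height K x (Suc n) =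
     (\<lambda>k. if x (Suc n) = k then Max (height K x n ` nbrs K k) + 1 else height K x n k)"

definition roots :: "nat \<Rightarrow> (nat \<Rightarrow> nat) \<Rightarrow> nat set" where
  "roots K x = {k \<in> {1..K}. \<exists>i\<ge>1. height K x i k = 1}"

definition num_roots :: "nat \<Rightarrow> (nat \<Rightarrow> nat) \<Rightarrow> nat" where
  "num_roots K x = card (roots K x)"

text \<open>
  \<open>root_loc K x j\<close> is the \<open>j\<close>-th smallest root, for \<open>1 \<le> j \<le> num_roots K x\<close>. There is at
  least one root whenever \<open>x 1 \<in> {1..K}\<close>.
\<close>

definition root_loc :: "nat \<Rightarrow> (nat \<Rightarrow> nat) \<Rightarrow> nat \<Rightarrow> nat" where
  "root_loc K x j = sorted_list_of_set (roots K x) ! (j - 1)"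

text \<open>The number of cyclically consecutive roots separated by \<open>i\<close> non-root sites, \<open>1 \<le> i \<le> K - 1\<close>.\<close>

definition gap_count :: "nat \<Rightarrow> nat \<Rightarrow> (nat \<Rightarrow> nat) \<Rightarrow> nat" where
  "gap_count i K x =
     (\<Sum>j = 1..num_roots K x - 1. of_bool (root_loc K x (j + 1) - root_loc K x j = i + 1))
     + of_bool (root_loc K x (num_roots K x) - root_loc K x 1 = K - i - 1)"

text \<open>
  The law of \<open>X n\<close> is a measure on all of \<open>nat\<close>, so \<open>X n\<close> lies in \<open>{1..K}\<close> almost surely.
\<close>

definition iid_uniform_sites :: "'a measure \<Rightarrow> nat \<Rightarrow> (nat \<Rightarrow> 'a \<Rightarrow> nat) \<Rightarrow> bool" where
  "iid_uniform_sites M K X \<longleftrightarrow>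
     prob_space.indep_vars M (\<lambda>_. count_space UNIV) X UNIV \<and>
     (\<forall>n. distr M (count_space UNIV) (X n) = measure_pmf (pmf_of_set {1..K}))"

definition D :: "nat \<Rightarrow> nat \<Rightarrow> (nat \<Rightarrow> 'a \<Rightarrow> nat) \<Rightarrow> 'a \<Rightarrow> real" where
  "D i K X \<omega> = real (gap_count i K (\<lambda>n. X n \<omega>))"

end

theory Submission
  imports Defs
begin

text \<open>
  When a site is hit for the first time, its height becomes \<open>1\<close> if and only if no neighbour has been
  hit before, and heights never decrease. So the roots are the local minima, around the cycle, of the
  times of first arrival (\<open>site_in_roots_iff\<close>). Only the order of these times matters, and since the
  law of the deposition sequence is invariant under relabelling the sites, this order is a uniformly
  random permutation (\<open>expectation_arrival_order\<close>). What remains is combinatorics of local minima of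
  a random order.

  The probability that the local minima along a path are exactly the points of a given set obeys a
  recursion. The point that comes first in the order is uniformly distributed. It is a local minimum,
  its neighbours are not, and it cuts the path into two pieces whose orders are again uniformly random
  and independent of each other (\<open>minima_at_first\<close>, \<open>prob_minima_at\<close>). In the configurations needed
  here, the first point has to be a prescribed minimum or an end of the path. The recursion thus runs
  over the lengths of the blocks between prescribed minima (\<open>block_prob_rec\<close>); it involves only few
  values for blocks of at most seven sites, and these are computed one after the other.

  The number of gaps of \<open>i\<close> sites is a sum of \<open>K\<close> indicators, one for each possible position of the
  first root. The indicator at \<open>k\<close> depends only on the order of the \<open>i + 4\<close> sites from \<open>k - 1\<close> to
  \<open>k + i + 2\<close>, and has expectation \<open>p = block_prob [1, i, 1]\<close>. Two indicators whose positions differ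
  by at least \<open>i + 4\<close> in both directions around the cycle are independent. For smaller nonzero
  differences they exclude each other, except that two gaps can share a root (difference \<open>i + 1\<close>,
  probability \<open>q = block_prob [1, i, i, 1]\<close>) or have one site between them (difference \<open>i + 3\<close>,
  probability \<open>s = block_prob [1, i, 1, i, 1]\<close>). Counting differences in both directions
  (\<open>expectation_gaps_square\<close>) gives the mean \<open>K * p\<close> and the variance
  \<open>K * (p + 2 * q + 2 * s - (2 * i + 7) * p\<^sup>2)\<close>.
\<close>

abbreviation random_order :: "'a set \<Rightarrow> 'a list pmf" where
  "random_order A \<equiv> pmf_of_set (permutations_of_set A)"

section \<open>Local minima of an order along a path\<close>

text \<open>
  Order of occurrence in a list. It is meant for two distinct members of the list: every member
  precedes itself and every element outside the list.
\<close>

primrec precedes :: "'a list \<Rightarrow> 'a \<Rightarrow> 'a \<Rightarrow> bool" where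
  "precedes [] a b = False"
| "precedes (x # xs) a b = (x = a \<or> x \<noteq> b \<and> precedes xs a b)"

text \<open>
  The set of interior points of the path \<open>p\<close> that come before both their neighbours is exactly the
  set of interior points lying in \<open>V\<close>. The end points have only one neighbour in the path and are
  left unconstrained; this makes the condition on a path the conjunction of the conditions on two
  subpaths that overlap in two points.
\<close>

fun minima_at :: "'a set \<Rightarrow> 'a list \<Rightarrow> 'a list \<Rightarrow> bool" where
  "minima_at V (a # b # c # p) xs \<longleftrightarrow>
     (b \<in> V \<longleftrightarrow> precedes xs b a \<and> precedes xs b c) \<and> minima_at V (b # c # p) xs"
| "minima_at V p xs \<longleftrightarrow> True"

lemma precedes_filter:
  "P a \<Longrightarrow> P b \<Longrightarrow> precedes (filter P xs) a b = precedes xs a b"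
  by (induction xs) auto

lemma precedes_antisym: "precedes xs a b \<Longrightarrow> precedes xs b a \<Longrightarrow> a = b"
  by (induction xs) auto

text \<open>
  The condition sees only the relative order of the points of the path, so events about disjoint
  paths are functions of disjoint parts of the order.
\<close>

lemma minima_at_filter:
  "set p \<subseteq> B \<Longrightarrow> minima_at V p (filter (\<lambda>x. x \<in> B) xs) = minima_at V p xs"
  by (induction V p xs rule: minima_at.induct) (auto simp: precedes_filter)

lemma minima_at_Cons_fresh:
  "x \<notin> set p \<Longrightarrow> minima_at V p (x # xs) = minima_at V p xs"
  by (induction V p xs rule: minima_at.induct) auto

lemma minima_at_append:
  "minima_at V (l @ a # b # r) xs \<longleftrightarrow> minima_at V (l @ [a, b]) xs \<and> minima_at V (a # b # r) xs"
proof (induction l)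
  case Nil
  then show ?case by simp
next
  case (Cons c l)
  then show ?case
  proof (cases l)
    case (Cons d l')
    then show ?thesis using Cons.IH by (cases l') auto
  qed auto
qed

text \<open>
  The first element \<open>x\<close> of the order is a local minimum wherever it is interior, and none of its
  neighbours is one. Conditions on a neighbour therefore only say that it is unmarked, and all other
  conditions do not involve \<open>x\<close>. The next two lemmas are the cases of \<open>x\<close> at an end of the path.
\<close>

lemma minima_at_first_left:
  assumes "x \<notin> set l" "distinct l" "l \<noteq> [] \<Longrightarrow> hd l \<notin> V"
  shows "minima_at V (l @ [x]) (x # xs) \<longleftrightarrow> (l \<noteq> [] \<longrightarrow> last l \<notin> V) \<and> minima_at V l xs"
proof (cases l rule: rev_cases)
  case (snoc l' b)
  show ?thesis
  proof (cases l' rule: rev_cases)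
    case (snoc l'' a)
    have eq: "l @ [x] = l'' @ a # b # [x]" and l: "l = l'' @ [a, b]"
      using snoc \<open>l = l' @ [b]\<close> by simp_all
    show ?thesis
      unfolding eq minima_at_append[of V l'' a b "[x]"] using assms(1,2) l
      by (auto simp: minima_at_Cons_fresh)
  qed (use snoc assms in auto)
qed auto

lemma minima_at_first_right:
  assumes "x \<notin> set r" "distinct r" "r \<noteq> [] \<Longrightarrow> last r \<notin> V"
  shows "minima_at V (x # r) (x # xs) \<longleftrightarrow> (r \<noteq> [] \<longrightarrow> hd r \<notin> V) \<and> minima_at V r xs"
proof (cases r)
  case (Cons b r')
  show ?thesis
  proof (cases r')
    case (Cons c r'')
    then show ?thesis using assms \<open>r = b # r'\<close> by (auto simp: minima_at_Cons_fresh)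
  qed (use Cons assms in auto)
qed auto

text \<open>
  The basis of all computations: removing the first element of the order cuts the path into two
  pieces with separate conditions. Its two neighbours become end points, which matches the
  requirement that the end points of a path are unmarked.
\<close>

lemma minima_at_first:
  assumes "distinct (l @ x # r)" "hd (l @ x # r) \<notin> V" "last (l @ x # r) \<notin> V"
  shows "minima_at V (l @ x # r) (x # xs) \<longleftrightarrow>
     (l = [] \<or> r = [] \<or> x \<in> V) \<and> (l \<noteq> [] \<longrightarrow> last l \<notin> V) \<and> (r \<noteq> [] \<longrightarrow> hd r \<notin> V) \<and>
     minima_at V l xs \<and> minima_at V r xs"
proof (cases "l = [] \<or> r = []")
  case True
  then show ?thesis using assms minima_at_first_left[of x l V xs] minima_at_first_right[of x r V xs]
    by (auto simp: hd_append split: if_splits)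
next
  case False
  then obtain l' a r' b where lr: "l = l' @ [a]" "r = b # r'"
    by (metis rev_exhaust neq_Nil_conv)
  have "minima_at V (l @ x # r) (x # xs) \<longleftrightarrow> minima_at V (l @ [x]) (x # xs) \<and>
          x \<in> V \<and> minima_at V (x # r) (x # xs)"
    unfolding lr using assms(1) minima_at_append[of V l' a x "b # r'" "x # xs"] lr
    by auto
  then show ?thesis
    using minima_at_first_left[of x l V xs] minima_at_first_right[of x r V xs] assms False
    by (auto simp: hd_append)
qed

section \<open>Uniformly random orders\<close>

lemma prob_pair_pmf_Times:
  "measure_pmf.prob (pair_pmf p q) (A \<times> B) = measure_pmf.prob p A * measure_pmf.prob q B"
proof -
  have "measure_pmf.prob (pair_pmf p q) (A \<times> B) =
        measure_pmf.prob (pair_pmf p q) ((A \<inter> set_pmf p) \<times> (B \<inter> set_pmf q))"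
    by (subst measure_Int_set_pmf[symmetric]) (simp add: Times_Int_Times)
  also have "\<dots> = measure_pmf.prob p (A \<inter> set_pmf p) * measure_pmf.prob q (B \<inter> set_pmf q)"
    by (rule measure_pmf_prob_product) (auto intro: countable_subset[OF _ countable_set_pmf])
  finally show ?thesis by (simp add: measure_Int_set_pmf)
qed

text \<open>
  A uniformly random order restricts to independent uniformly random orders on disjoint sets: split
  the order along \<open>B\<close>, and then the part outside \<open>B\<close> along \<open>C\<close>.
\<close>

lemma prob_random_order_disjoint_filters:
  assumes "finite A" "B \<subseteq> A" "C \<subseteq> A" "B \<inter> C = {}"
  shows "measure_pmf.prob (random_order A)
           {xs. P (filter (\<lambda>x. x \<in> B) xs) \<and> Q (filter (\<lambda>x. x \<in> C) xs)} =
         measure_pmf.prob (random_order B) {xs. P xs} * measure_pmf.prob (random_order C) {xs. Q xs}"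
proof -
  have part: "map_pmf (partition (\<lambda>x. x \<in> B')) (random_order A') = pair_pmf (random_order B') (random_order (A' - B'))"
    if "finite A'" "B' \<subseteq> A'" for A' B' :: "'a set"
  proof -
    have "{x \<in> A'. x \<in> B'} = B'" "{x \<in> A'. x \<notin> B'} = A' - B'" using that by auto
    then show ?thesis using partition_random_permutations[OF that(1), of "\<lambda>x. x \<in> B'"] by simp
  qed
  have marg: "map_pmf (filter (\<lambda>x. x \<in> C)) (random_order (A - B)) = random_order C"
  proof -
    have "map_pmf (filter (\<lambda>x. x \<in> C)) (random_order (A - B)) =
          map_pmf fst (map_pmf (partition (\<lambda>x. x \<in> C)) (random_order (A - B)))"
      by (simp add: pmf.map_comp o_def)
    also have "\<dots> = random_order C"
      using assms by (subst part) (auto simp: map_fst_pair_pmf)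
    finally show ?thesis .
  qed
  have *: "filter (\<lambda>x. x \<in> C) xs = filter (\<lambda>x. x \<in> C) (filter (\<lambda>x. x \<notin> B) xs)" for xs
    using assms(4) by (auto simp: intro!: filter_cong)
  have "measure_pmf.prob (random_order A)
           {xs. P (filter (\<lambda>x. x \<in> B) xs) \<and> Q (filter (\<lambda>x. x \<in> C) xs)} =
        measure_pmf.prob (map_pmf (partition (\<lambda>x. x \<in> B)) (random_order A))
           ({ys. P ys} \<times> {zs. Q (filter (\<lambda>x. x \<in> C) zs)})"
    by (subst measure_map_pmf, subst *) (auto intro!: arg_cong[where f = "measure_pmf.prob _"] simp: o_def)
  also have "\<dots> = measure_pmf.prob (random_order B) {xs. P xs} *
                   measure_pmf.prob (random_order (A - B)) {zs. Q (filter (\<lambda>x. x \<in> C) zs)}"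
    by (subst part[OF assms(1,2)], subst prob_pair_pmf_Times) auto
  also have "measure_pmf.prob (random_order (A - B)) {zs. Q (filter (\<lambda>x. x \<in> C) zs)} =
             measure_pmf.prob (random_order C) {xs. Q xs}"
    by (subst marg[symmetric]) (simp add: vimage_def)
  finally show ?thesis .
qed

lemma prob_minima_at_disjoint:
  assumes "finite A" "set p \<subseteq> A" "set q \<subseteq> A" "set p \<inter> set q = {}"
  shows "measure_pmf.prob (random_order A) {xs. minima_at V p xs \<and> minima_at W q xs} =
         measure_pmf.prob (random_order (set p)) {xs. minima_at V p xs} *
         measure_pmf.prob (random_order (set q)) {xs. minima_at W q xs}"
  using prob_random_order_disjoint_filters[OF assms, of "minima_at V p" "minima_at W q"]
  by (simp add: minima_at_filter)

lemma prob_minima_at_restrict: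
  assumes "finite A" "set p \<subseteq> A"
  shows "measure_pmf.prob (random_order A) {xs. minima_at V p xs} =
         measure_pmf.prob (random_order (set p)) {xs. minima_at V p xs}"
  using prob_minima_at_disjoint[of A p "[]"] assms by simp

text \<open>
  Conditioned on its first element, which is uniform, the rest of the order is a uniformly random
  order of the other elements.
\<close>

lemma prob_random_order_first:
  assumes "finite A" "A \<noteq> {}"
  shows "measure_pmf.prob (random_order A) {xs. P xs} =
         (\<Sum>x\<in>A. measure_pmf.prob (random_order (A - {x})) {xs. P (x # xs)}) / card A"
proof -
  have "measure_pmf.prob (random_order A) {xs. P xs} =
     measure_pmf.prob (pmf_of_set A \<bind> (\<lambda>x. map_pmf ((#) x) (random_order (A - {x})))) {xs. P xs}"
    by (subst random_permutation_of_set[OF assms]) (simp add: map_pmf_def)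
  also have "\<dots> = measure_pmf.expectation
       (pmf_of_set A \<bind> (\<lambda>x. map_pmf ((#) x) (random_order (A - {x})))) (indicator {xs. P xs})"
    by simp
  also have "\<dots> = (\<Sum>x\<in>A. measure_pmf.expectation (map_pmf ((#) x) (random_order (A - {x})))
                       (indicator {xs. P xs}) / card A)"
    using assms by (subst pmf_expectation_bind_pmf_of_set) (auto simp: divide_inverse mult.commute)
  also have "\<dots> = (\<Sum>x\<in>A. measure_pmf.prob (random_order (A - {x})) {xs. P (x # xs)}) / card A"
    by (simp add: sum_divide_distrib vimage_def del: integral_map_pmf)
  finally show ?thesis .
qed

section \<open>Recursion on the first element of a random order\<close>

text \<open>
  For a path with marks \<open>l\<close>, \<open>m\<close>, \<open>r\<close> and unmarked end points, the condition under which its point with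
  mark \<open>m\<close> may come first in the order; cf. \<open>minima_at_first\<close>.
\<close>

definition first_splits :: "bool list \<Rightarrow> bool \<Rightarrow> bool list \<Rightarrow> bool" where
  "first_splits l m r \<longleftrightarrow>
     (l = [] \<or> r = [] \<or> m) \<and> (l \<noteq> [] \<longrightarrow> \<not> last l) \<and> (r \<noteq> [] \<longrightarrow> \<not> hd r)"

text \<open>
  The probability of prescribed local minima depends on the path only through its marks. Condition
  on the position \<open>j\<close> of the first element: the binomial coefficients of a counting argument are
  absorbed by the factors of the two independent pieces.
\<close>

function word_prob :: "bool list \<Rightarrow> real" where
  "word_prob w = (if w = [] then 1 else
     (\<Sum>j<length w. of_bool (first_splits (take j w) (w ! j) (drop (Suc j) w)) *
        (word_prob (take j w) * word_prob (drop (Suc j) w))) / real (length w))"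
  by auto
termination by (relation "Wellfounded.measure length") auto

declare word_prob.simps [simp del]

lemma word_prob_Nil [simp]: "word_prob [] = 1"
  by (simp add: word_prob.simps)

text \<open>
  By induction on the length of the path: the first element is uniform on the path, it either
  contradicts the marks or cuts the path in two, and the orders on the two pieces are independent.
\<close>

theorem prob_minima_at:
  assumes "distinct p" "p \<noteq> [] \<Longrightarrow> hd p \<notin> V" "p \<noteq> [] \<Longrightarrow> last p \<notin> V"
  shows "measure_pmf.prob (random_order (set p)) {xs. minima_at V p xs} =
         word_prob (map (\<lambda>x. x \<in> V) p)"
  using assms
proof (induction p rule: length_induct)
  case (1 p)
  let ?m = "map (\<lambda>x. x \<in> V)"
  let ?P = "\<lambda>A p. measure_pmf.prob (random_order A) {xs. minima_at V p xs}"
  show ?case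
  proof (cases "p = []")
    case True
    then show ?thesis by simp
  next
    case False
    have step: "measure_pmf.prob (random_order (set p - {p ! j})) {xs. minima_at V p (p ! j # xs)} =
        of_bool (first_splits (take j (?m p)) (?m p ! j) (drop (Suc j) (?m p))) *
          (word_prob (take j (?m p)) * word_prob (drop (Suc j) (?m p)))" if j: "j < length p" for j
    proof -
      define l x r where "l = take j p" and "x = p ! j" and "r = drop (Suc j) p"
      have p: "p = l @ x # r" using j id_take_nth_drop l_def r_def x_def by metis
      have lx: "length l = j" using j by (simp add: l_def)
      have d: "distinct (l @ x # r)" and ends: "hd (l @ x # r) \<notin> V" "last (l @ x # r) \<notin> V"
        using 1(2-4) False p by auto
      have A: "set p - {x} = set l \<union> set r" using d p by auto
      let ?ok = "first_splits (?m l) (x \<in> V) (?m r)"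
      have iff: "minima_at V p (x # xs) \<longleftrightarrow> ?ok \<and> minima_at V l xs \<and> minima_at V r xs" for xs
        unfolding p minima_at_first[OF d ends] first_splits_def
        by (auto simp: last_map hd_map)
      have "measure_pmf.prob (random_order (set p - {x})) {xs. minima_at V p (x # xs)} =
            of_bool ?ok * (?P (set l) l * ?P (set r) r)"
        unfolding iff A using prob_minima_at_disjoint[of "set l \<union> set r" l r V V] d
        by (cases ?ok) auto
      also have "\<dots> = of_bool ?ok * (word_prob (?m l) * word_prob (?m r))"
      proof (cases ?ok)
        case True
        have "l \<noteq> [] \<Longrightarrow> hd l \<notin> V" "l \<noteq> [] \<Longrightarrow> last l \<notin> V"
          using True ends by (auto simp: first_splits_def last_map)
        then have "?P (set l) l = word_prob (?m l)"
          using d 1(1) p by auto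
        moreover have "r \<noteq> [] \<Longrightarrow> hd r \<notin> V" "r \<noteq> [] \<Longrightarrow> last r \<notin> V"
          using True ends by (auto simp: first_splits_def hd_map)
        then have "?P (set r) r = word_prob (?m r)"
          using d 1(1) p by auto
        ultimately show ?thesis by simp
      qed auto
      finally show ?thesis
        using j by (simp add: l_def r_def x_def take_map drop_map)
    qed
    have "?P (set p) p = (\<Sum>x\<in>set p. measure_pmf.prob (random_order (set p - {x}))
              {xs. minima_at V p (x # xs)}) / card (set p)"
      using False by (intro prob_random_order_first) auto
    also have "(\<Sum>x\<in>set p. measure_pmf.prob (random_order (set p - {x})) {xs. minima_at V p (x # xs)}) =
       (\<Sum>j<length p. measure_pmf.prob (random_order (set p - {p ! j})) {xs. minima_at V p (p ! j # xs)})"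
      using \<open>distinct p\<close> by (intro sum.reindex_bij_betw[symmetric] bij_betw_nth) auto
    also have "card (set p) = length p" using \<open>distinct p\<close> by (rule distinct_card)
    finally show ?thesis
      using False by (subst word_prob.simps) (simp add: step)
  qed
qed

section \<open>Isolated marks and the blocks between them\<close>

lemma word_prob_rev: "word_prob (rev w) = word_prob w"
proof (induction w rule: length_induct)
  case (1 w)
  define n where "n = length w"
  have "(\<Sum>j<n. of_bool (first_splits (take j (rev w)) (rev w ! j) (drop (Suc j) (rev w))) *
           (word_prob (take j (rev w)) * word_prob (drop (Suc j) (rev w)))) =
        (\<Sum>j<n. of_bool (first_splits (take (n - Suc j) (rev w)) (rev w ! (n - Suc j))
              (drop (Suc (n - Suc j)) (rev w))) *
           (word_prob (take (n - Suc j) (rev w)) * word_prob (drop (Suc (n - Suc j)) (rev w))))"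
    by (rule sum.nat_diff_reindex[symmetric])
  also have "\<dots> = (\<Sum>j<n. of_bool (first_splits (take j w) (w ! j) (drop (Suc j) w)) *
           (word_prob (take j w) * word_prob (drop (Suc j) w)))"
  proof (rule sum.cong)
    fix j assume "j \<in> {..<n}"
    then have j: "j < n" by simp
    have r: "take (n - Suc j) (rev w) = rev (drop (Suc j) w)"
      "drop (Suc (n - Suc j)) (rev w) = rev (take j w)" "rev w ! (n - Suc j) = w ! j"
      using j by (auto simp: n_def rev_nth take_rev drop_rev)
    have "word_prob (rev (drop (Suc j) w)) = word_prob (drop (Suc j) w)"
      "word_prob (rev (take j w)) = word_prob (take j w)"
      using 1 j by (auto simp: n_def)
    then show "of_bool (first_splits (take (n - Suc j) (rev w)) (rev w ! (n - Suc j))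
              (drop (Suc (n - Suc j)) (rev w))) *
           (word_prob (take (n - Suc j) (rev w)) * word_prob (drop (Suc (n - Suc j)) (rev w))) =
        of_bool (first_splits (take j w) (w ! j) (drop (Suc j) w)) *
           (word_prob (take j w) * word_prob (drop (Suc j) w))"
      unfolding r by (auto simp: first_splits_def hd_rev last_rev mult.commute)
  qed simp
  finally show ?case
    by (subst (1 2) word_prob.simps) (simp add: n_def)
qed

text \<open>
  The marks occurring below are isolated, so a word of marks is encoded by the lengths of the blocks
  of unmarked points before, between and after the marked ones.
\<close>

fun block_word :: "nat list \<Rightarrow> bool list" where
  "block_word [] = []"
| "block_word [m] = replicate m False"
| "block_word (m # n # ms) = replicate m False @ True # block_word (n # ms)"

lemma block_word_append:
  "us \<noteq> [] \<Longrightarrow> ms \<noteq> [] \<Longrightarrow> block_word (us @ ms) = block_word us @ True # block_word ms"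
  by (induction us rule: block_word.induct) (auto simp: neq_Nil_conv)

lemma length_block_word: "ms \<noteq> [] \<Longrightarrow> Suc (length (block_word ms)) = sum_list ms + length ms"
  by (induction ms rule: block_word.induct) auto

lemma rev_block_word: "rev (block_word ms) = block_word (rev ms)"
proof (induction ms rule: block_word.induct)
  case (3 m n ms)
  then show ?case using block_word_append[of "rev ms @ [n]" "[m]"] by simp
qed auto

text \<open>
  For instance, \<open>block_prob [1, i, 1]\<close> is the probability that in a path of \<open>i + 4\<close> points the second
  and the last but one are the only local minima in the interior.
\<close>

definition block_prob :: "nat list \<Rightarrow> real" where
  "block_prob ms = word_prob (block_word ms)"

lemma block_prob_rev: "block_prob (rev ms) = block_prob ms"
  by (simp add: block_prob_def word_prob_rev flip: rev_block_word)

definition split_term :: "bool list \<Rightarrow> bool \<Rightarrow> bool list \<Rightarrow> real" where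
  "split_term l m r = of_bool (first_splits l m r) * (word_prob l * word_prob r)"

text \<open>
  The sum in the recursion for \<open>word_prob\<close>, read off while walking through the word \<open>l @ r\<close>: only
  first elements in the second part are counted.
\<close>

primrec split_sum :: "bool list \<Rightarrow> bool list \<Rightarrow> real" where
  "split_sum l [] = 0"
| "split_sum l (m # r) = split_term l m r + split_sum (l @ [m]) r"

lemma split_sum_eq:
  "split_sum l w = (\<Sum>j<length w. split_term (l @ take j w) (w ! j) (drop (Suc j) w))"
  by (induction w arbitrary: l) (auto simp: sum.lessThan_Suc_shift simp del: sum.lessThan_Suc)

lemma word_prob_split_sum:
  "w \<noteq> [] \<Longrightarrow> word_prob w * length w = split_sum [] w"
  by (subst word_prob.simps) (simp add: split_sum_eq split_term_def)

text \<open>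
  An unmarked interior point is not a local minimum, so it never comes first.
\<close>

lemma split_sum_skip:
  "l \<noteq> [] \<Longrightarrow> r \<noteq> [] \<Longrightarrow> split_sum l (replicate a False @ r) = split_sum (l @ replicate a False) r"
  by (induction a arbitrary: l) (auto simp: split_term_def first_splits_def)

text \<open>
  The same sum in terms of blocks. The first element is either a marked point, which cuts between two
  blocks, or the right end of the path, which shortens the last block. The latter is impossible if this
  block is a single point, since the right end then has a marked neighbour.
\<close>

primrec cut_sum :: "nat list \<Rightarrow> nat list \<Rightarrow> real" where
  "cut_sum us [] = 0"
| "cut_sum us (m # ms) =
     (if ms = [] then (if m = 1 then 0 else block_prob (us @ [m - 1]))
      else block_prob (us @ [m]) * block_prob ms + cut_sum (us @ [m]) ms)"

lemma hd_block_word: "ms \<noteq> [] \<Longrightarrow> 0 \<notin> set ms \<Longrightarrow> block_word ms \<noteq> [] \<and> \<not> hd (block_word ms)"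
  by (induction ms rule: block_word.induct) (auto simp: hd_append)

lemma last_block_word: "ms \<noteq> [] \<Longrightarrow> 0 \<notin> set ms \<Longrightarrow> \<not> last (block_word ms)"
proof (induction ms rule: block_word.induct)
  case (3 m n ms)
  then show ?case using hd_block_word[of "n # ms"] by auto
qed auto

lemma split_sum_block_word:
  assumes "us \<noteq> []" "ms \<noteq> []" "0 \<notin> set us" "0 \<notin> set ms"
  shows "split_sum (block_word us @ [True]) (block_word ms) = cut_sum us ms"
  using assms
proof (induction ms arbitrary: us)
  case (Cons m ms)
  show ?case
  proof (cases "ms = []")
    case True
    obtain a where m: "m = Suc a" using Cons.prems by (cases m) auto
    have "split_sum (block_word us @ [True]) (block_word [m]) =
          split_sum (block_word us @ [True]) (replicate a False @ [False])"
      by (simp add: m replicate_append_same)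
    also have "\<dots> = split_sum (block_word us @ True # replicate a False) [False]"
      by (subst split_sum_skip) auto
    also have "\<dots> = cut_sum us [m]"
      using block_word_append[of us "[a]"] Cons.prems
      by (cases a rule: nat.exhaust)
         (auto simp: m split_term_def first_splits_def block_prob_def
               simp flip: replicate_append_same simp del: replicate.simps)
    finally show ?thesis using True by simp
  next
    case False
    have *: "block_word (us @ [m]) = block_word us @ True # replicate m False"
      using block_word_append[of us "[m]"] Cons.prems by simp
    have "split_sum (block_word us @ [True]) (block_word (m # ms)) =
          split_sum (block_word us @ [True]) (replicate m False @ True # block_word ms)"
      using False by (cases ms) auto
    also have "\<dots> = split_sum (block_word (us @ [m])) (True # block_word ms)"
      by (subst split_sum_skip) (auto simp: *)
    also have "\<dots> = split_term (block_word (us @ [m])) True (block_word ms) + cut_sum (us @ [m]) ms"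
      using Cons False by simp
    also have "split_term (block_word (us @ [m])) True (block_word ms) =
               block_prob (us @ [m]) * block_prob ms"
      using last_block_word[of "us @ [m]"] hd_block_word[of ms] Cons.prems False
      by (auto simp: split_term_def first_splits_def block_prob_def)
    finally show ?thesis using False by simp
  qed
qed simp

lemma block_prob_single:
  "block_prob [1] = 1"
  "m \<ge> 2 \<Longrightarrow> block_prob [m] = 2 / m * block_prob [m - 1]"
proof -
  show "block_prob [1] = 1"
    using word_prob_split_sum[of "[False]"]
    by (simp add: block_prob_def split_term_def first_splits_def)
next
  assume "m \<ge> 2"
  then have "m = Suc (Suc (m - 2))" by simp
  then obtain a where m: "m = Suc (Suc a)" ..
  have "block_prob [m] * m = split_sum [] (False # replicate a False @ [False])"
    using word_prob_split_sum[of "block_word [m]"]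
    by (simp add: m block_prob_def replicate_append_same)
  also have "\<dots> = split_term [] False (replicate a False @ [False]) +
                   split_term (False # replicate a False) False []"
    by (simp add: split_sum_skip)
  also have "\<dots> = 2 * block_prob [m - 1]"
    by (simp add: m split_term_def first_splits_def block_prob_def replicate_append_same
       )
  finally show "block_prob [m] = 2 / m * block_prob [m - 1]" using \<open>m \<ge> 2\<close> by (simp add: field_simps)
qed

text \<open>
  The first element of the order is one of the marked points or an end of the path; an end shortens its
  block and comes first only if this block has at least two points. This reduces the number of summands from the length of the path to at most the number of blocks plus one.
\<close>

theorem block_prob_rec:
  assumes "0 \<notin> set (m # n # ms)"
  shows "block_prob (m # n # ms) =
    ((if m = 1 then 0 else block_prob ((m - 1) # n # ms)) +
     block_prob [m] * block_prob (n # ms) + cut_sum [m] (n # ms)) /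
    (real (sum_list (m # n # ms)) + real (length ms) + 1)"
proof -
  obtain a where m: "m = Suc a" using assms by (cases m) auto
  let ?w = "block_word (m # n # ms)"
  let ?r = "block_word (n # ms)"
  have w: "?w = False # replicate a False @ True # ?r" by (simp add: m)
  have "block_prob (m # n # ms) * length ?w = split_sum [] ?w"
    using word_prob_split_sum[of ?w] by (simp add: block_prob_def)
  also have "\<dots> = split_term [] False (replicate a False @ True # ?r) +
                   split_term (block_word [m]) True ?r + split_sum (block_word [m] @ [True]) ?r"
    by (simp add: w m split_sum_skip)
  also have "split_term [] False (replicate a False @ True # ?r) =
             (if m = 1 then 0 else block_prob ((m - 1) # n # ms))"
    by (cases a) (auto simp: m split_term_def first_splits_def block_prob_def)
  also have "split_term (block_word [m]) True ?r = block_prob [m] * block_prob (n # ms)"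
    using hd_block_word[of "n # ms"] assms
    by (auto simp: m split_term_def first_splits_def block_prob_def
             simp flip: replicate_append_same simp del: replicate.simps)
  also have "split_sum (block_word [m] @ [True]) ?r = cut_sum [m] (n # ms)"
    using assms by (intro split_sum_block_word) auto
  finally have "block_prob (m # n # ms) * length ?w =
     (if m = 1 then 0 else block_prob ((m - 1) # n # ms)) +
     block_prob [m] * block_prob (n # ms) + cut_sum [m] (n # ms)" .
  moreover have "real (length ?w) = real (sum_list (m # n # ms)) + real (length ms) + 1"
    using arg_cong[OF length_block_word[of "m # n # ms"], of real] by simp
  ultimately show ?thesis by (simp add: field_simps)
qed

section \<open>Values for blocks of length at most seven\<close>

text \<open>
  Reflecting the path identifies about half of the values that are tabulated below.
\<close>

lemma block_prob_reorder:
  "n < m \<Longrightarrow> block_prob [m, n] = block_prob [n, m]"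
  "k < m \<Longrightarrow> block_prob [m, n, k] = block_prob [k, n, m]"
  "j < m \<Longrightarrow> block_prob [m, n, k, j] = block_prob [j, k, n, m]"
  using block_prob_rev[of "[n, m]"] block_prob_rev[of "[k, n, m]"] block_prob_rev[of "[j, k, n, m]"]
  by simp_all

context
  \<comment> \<open>The rules in \<open>block_prob_reorder\<close> permute their arguments, so rewriting also requires a descent
    in the term order, which disagrees with the order of numbers on \<open>5\<close> and \<open>6\<close>. The instances
    for these two numbers are not permutative.\<close>
  notes block_prob_reorder [simp] and block_prob_reorder(1)[of 5 6, simp]
    and block_prob_reorder(2)[of 5 6 1, simp] and One_nat_def [simp del] One_nat_def [symmetric, simp]
begin

text \<open>
  The values are computed once and used as rewrite rules in later rows, since unfolding the recursion
  completely would visit the same arguments exponentially often.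
\<close>

lemma single_block_values:
  "block_prob [1] = 1"
  "block_prob [2] = 1"
  "block_prob [3] = 2 / 3"
  "block_prob [4] = 1 / 3"
  "block_prob [5] = 2 / 15"
  "block_prob [6] = 2 / 45"
  "block_prob [7] = 4 / 315"
  by (simp_all add: block_prob_single)

lemma two_block_values_1:
  "block_prob [1, 1] = 1 / 3"
  "block_prob [1, 2] = 1 / 3"
  "block_prob [1, 3] = 1 / 5"
  "block_prob [1, 4] = 4 / 45"
  "block_prob [1, 5] = 2 / 63"
  "block_prob [1, 6] = 1 / 105"
  "block_prob [1, 7] = 1 / 405"
  by (simp_all add: block_prob_rec[of 1] single_block_values)

lemma two_block_values_2:
  "block_prob [2, 2] = 1 / 3"
  "block_prob [2, 3] = 1 / 5"
  "block_prob [2, 4] = 4 / 45"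
  "block_prob [2, 5] = 2 / 63"
  "block_prob [2, 6] = 1 / 105"
  "block_prob [2, 7] = 1 / 405"
  by (simp_all add: block_prob_rec[of 2] single_block_values two_block_values_1)

lemma two_block_values_3:
  "block_prob [3, 3] = 38 / 315"
  "block_prob [3, 4] = 17 / 315"
  "block_prob [3, 5] = 11 / 567"
  "block_prob [3, 6] = 83 / 14175"
  "block_prob [3, 7] = 34 / 22275"
  by (simp_all add: block_prob_rec[of 3] single_block_values two_block_values_1
      two_block_values_2)

lemma two_block_values_4:
  "block_prob [4, 4] = 23 / 945"
  "block_prob [4, 5] = 5 / 567"
  "block_prob [4, 6] = 38 / 14175"
  "block_prob [4, 7] = 47 / 66825"
  by (simp_all add: block_prob_rec[of 4] single_block_values two_block_values_1
      two_block_values_2 two_block_values_3)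

lemma two_block_values_5:
  "block_prob [5, 5] = 502 / 155925"
  "block_prob [5, 6] = 461 / 467775"
  "block_prob [5, 7] = 226 / 868725"
  by (simp_all add: block_prob_rec[of 5] single_block_values two_block_values_1
      two_block_values_2 two_block_values_3 two_block_values_4)

lemma two_block_values_6:
  "block_prob [6, 6] = 142 / 467775"
  "block_prob [6, 7] = 14 / 173745"
  by (simp_all add: block_prob_rec[of 6] single_block_values two_block_values_1
      two_block_values_2 two_block_values_3 two_block_values_4 two_block_values_5)

lemma two_block_values_7:
  "block_prob [7, 7] = 13724 / 638512875"
  by (simp_all add: block_prob_rec[of 7] single_block_values two_block_values_1
      two_block_values_2 two_block_values_3 two_block_values_4 two_block_values_5
      two_block_values_6)

lemmas up_to_two_block_values = single_block_values two_block_values_1 two_block_values_2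
      two_block_values_3 two_block_values_4 two_block_values_5 two_block_values_6
      two_block_values_7

lemma three_block_values_end_2:
  "block_prob [1, 2, 1] = 1 / 9"
  "block_prob [1, 2, 2] = 1 / 9"
  by (simp_all add: block_prob_rec[of 1 2] up_to_two_block_values)

lemma three_block_values_end_3:
  "block_prob [1, 3, 1] = 2 / 35"
  "block_prob [1, 3, 2] = 2 / 35"
  "block_prob [1, 3, 3] = 14 / 405"
  by (simp_all add: block_prob_rec[of 1 3] up_to_two_block_values)

lemma three_block_values_end_4:
  "block_prob [1, 4, 1] = 1 / 45"
  "block_prob [1, 4, 2] = 1 / 45"
  "block_prob [1, 4, 3] = 64 / 4725"
  "block_prob [1, 4, 4] = 29 / 4725"
  by (simp_all add: block_prob_rec[of 1 4] up_to_two_block_values)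

lemma three_block_values_end_5:
  "block_prob [1, 5, 1] = 4 / 567"
  "block_prob [1, 5, 2] = 4 / 567"
  "block_prob [1, 5, 3] = 1 / 231"
  "block_prob [1, 5, 4] = 37 / 18711"
  "block_prob [1, 5, 5] = 401 / 552825"
  by (simp_all add: block_prob_rec[of 1 5] up_to_two_block_values)

lemma three_block_values_end_6:
  "block_prob [1, 6, 1] = 1 / 525"
  "block_prob [1, 6, 2] = 1 / 525"
  "block_prob [1, 6, 3] = 2 / 1701"
  "block_prob [1, 6, 4] = 23 / 42525"
  "block_prob [1, 6, 5] = 218 / 1091475"
  "block_prob [1, 6, 6] = 3034 / 49116375"
  by (simp_all add: block_prob_rec[of 1 6] up_to_two_block_values)

lemma three_block_values_end_7:
  "block_prob [1, 7, 1] = 2 / 4455"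
  "block_prob [1, 7, 2] = 2 / 4455"
  "block_prob [1, 7, 3] = 22 / 78975"
  "block_prob [1, 7, 4] = 112 / 868725"
  "block_prob [1, 7, 5] = 16 / 334125"
  "block_prob [1, 7, 6] = 194 / 13030875"
  "block_prob [1, 7, 7] = 346 / 86837751"
  by (simp_all add: block_prob_rec[of 1 7] up_to_two_block_values)

lemma three_block_values_mid_1:
  "block_prob [1, 1, 1] = 2 / 15"
  "block_prob [1, 1, 2] = 2 / 15"
  "block_prob [1, 1, 3] = 5 / 63"
  "block_prob [1, 1, 4] = 11 / 315"
  "block_prob [1, 1, 5] = 1 / 81"
  "block_prob [1, 1, 6] = 52 / 14175"
  "block_prob [1, 1, 7] = 7 / 7425"
  by (simp_all add: block_prob_rec[of 1 1] up_to_two_block_values)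

lemma three_block_values_mid_2:
  "block_prob [2, 1, 2] = 2 / 15"
  "block_prob [2, 1, 3] = 5 / 63"
  "block_prob [2, 1, 4] = 11 / 315"
  "block_prob [2, 1, 5] = 1 / 81"
  "block_prob [2, 1, 6] = 52 / 14175"
  "block_prob [2, 1, 7] = 7 / 7425"
  by (simp_all add: block_prob_rec[of 2 1] up_to_two_block_values three_block_values_mid_1)

lemma three_block_values_mid_3:
  "block_prob [3, 1, 3] = 134 / 2835"
  "block_prob [3, 1, 4] = 59 / 2835"
  "block_prob [3, 1, 5] = 164 / 22275"
  "block_prob [3, 1, 6] = 1024 / 467775"
  "block_prob [3, 1, 7] = 163 / 289575"
  by (simp_all add: block_prob_rec[of 3 1] up_to_two_block_values three_block_values_mid_1
      three_block_values_mid_2)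

lemma three_block_values_mid_4:
  "block_prob [4, 1, 4] = 26 / 2835"
  "block_prob [4, 1, 5] = 217 / 66825"
  "block_prob [4, 1, 6] = 452 / 467775"
  "block_prob [4, 1, 7] = 8 / 32175"
  by (simp_all add: block_prob_rec[of 4 1] up_to_two_block_values three_block_values_mid_1
      three_block_values_mid_2 three_block_values_mid_3)

lemma three_block_values_mid_5:
  "block_prob [5, 1, 5] = 6998 / 6081075"
  "block_prob [5, 1, 6] = 2084 / 6081075"
  "block_prob [5, 1, 7] = 18782 / 212837625"
  by (simp_all add: block_prob_rec[of 5 1] up_to_two_block_values three_block_values_mid_1
      three_block_values_mid_2 three_block_values_mid_3 three_block_values_mid_4)

lemma three_block_values_mid_6:
  "block_prob [6, 1, 6] = 9316 / 91216125"
  "block_prob [6, 1, 7] = 1867 / 70945875"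
  by (simp_all add: block_prob_rec[of 6 1] up_to_two_block_values three_block_values_mid_1
      three_block_values_mid_2 three_block_values_mid_3 three_block_values_mid_4
      three_block_values_mid_5)

lemma three_block_values_mid_7:
  "block_prob [7, 1, 7] = 73646 / 10854718875"
  by (simp_all add: block_prob_rec[of 7 1] up_to_two_block_values three_block_values_mid_1
      three_block_values_mid_2 three_block_values_mid_3 three_block_values_mid_4
      three_block_values_mid_5 three_block_values_mid_6)

lemmas up_to_three_block_values = up_to_two_block_values 
      three_block_values_end_2 three_block_values_end_3 three_block_values_end_4
      three_block_values_end_5 three_block_values_end_6 three_block_values_end_7
      three_block_values_mid_1 three_block_values_mid_2 three_block_values_mid_3
      three_block_values_mid_4 three_block_values_mid_5 three_block_values_mid_6
      three_block_values_mid_7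

lemma four_block_values_2:
  "block_prob [1, 2, 1, 1] = 2 / 45"
  "block_prob [1, 2, 1, 2] = 2 / 45"
  by (simp_all add: block_prob_rec[of 1 2] up_to_three_block_values)

lemma four_block_values_3:
  "block_prob [1, 3, 1, 1] = 64 / 2835"
  "block_prob [1, 3, 1, 2] = 64 / 2835"
  "block_prob [1, 3, 1, 3] = 233 / 17325"
  by (simp_all add: block_prob_rec[of 1 3] up_to_three_block_values)

lemma four_block_values_4:
  "block_prob [1, 4, 1, 1] = 41 / 4725"
  "block_prob [1, 4, 1, 2] = 41 / 4725"
  "block_prob [1, 4, 1, 3] = 44 / 8505"
  "block_prob [1, 4, 1, 4] = 97 / 42525"
  by (simp_all add: block_prob_rec[of 1 4] up_to_three_block_values)

lemma four_block_values_5: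
  "block_prob [1, 5, 1, 1] = 17 / 6237"
  "block_prob [1, 5, 1, 2] = 17 / 6237"
  "block_prob [1, 5, 1, 3] = 899 / 552825"
  "block_prob [1, 5, 1, 4] = 4364 / 6081075"
  "block_prob [1, 5, 1, 5] = 4166 / 16372125"
  by (simp_all add: block_prob_rec[of 1 5] up_to_three_block_values)

lemma four_block_values_6:
  "block_prob [1, 6, 1, 1] = 31 / 42525"
  "block_prob [1, 6, 1, 2] = 31 / 42525"
  "block_prob [1, 6, 1, 3] = 19 / 43659"
  "block_prob [1, 6, 1, 4] = 1888 / 9823275"
  "block_prob [1, 6, 1, 5] = 6221 / 91216125"
  "block_prob [1, 6, 1, 6] = 4328 / 212837625"
  by (simp_all add: block_prob_rec[of 1 6] up_to_three_block_values)

lemma four_block_values_7: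
  "block_prob [1, 7, 1, 1] = 148 / 868725"
  "block_prob [1, 7, 1, 2] = 148 / 868725"
  "block_prob [1, 7, 1, 3] = 34 / 334125"
  "block_prob [1, 7, 1, 4] = 586 / 13030875"
  "block_prob [1, 7, 1, 5] = 34666 / 2170943775"
  "block_prob [1, 7, 1, 6] = 51712 / 10854718875"
  "block_prob [1, 7, 1, 7] = 134161 / 109185701625"
  by (simp_all add: block_prob_rec[of 1 7] up_to_three_block_values)

lemmas up_to_four_block_values = up_to_three_block_values four_block_values_2 four_block_values_3
      four_block_values_4 four_block_values_5 four_block_values_6 four_block_values_7

text \<open>
  The three families that determine mean and variance: a single gap of \<open>i\<close> sites, two such gaps
  sharing a root, and two such gaps separated by a single site.
\<close>

lemma gap_values:
  "block_prob [1, 2, 1] = 1 / 9"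
  "block_prob [1, 3, 1] = 2 / 35"
  "block_prob [1, 4, 1] = 1 / 45"
  "block_prob [1, 5, 1] = 4 / 567"
  "block_prob [1, 6, 1] = 1 / 525"
  "block_prob [1, 7, 1] = 2 / 4455"
  by (simp_all add: up_to_three_block_values)

lemma adjacent_gaps_values:
  "block_prob [1, 2, 2, 1] = 1 / 27"
  "block_prob [1, 3, 3, 1] = 221 / 22275"
  "block_prob [1, 4, 4, 1] = 22 / 14175"
  "block_prob [1, 5, 5, 1] = 9514 / 58046625"
  "block_prob [1, 6, 6, 1] = 619 / 49116375"
  "block_prob [1, 7, 7, 1] = 274819 / 371231385525"
  by (simp_all add: block_prob_rec up_to_four_block_values)

lemma separated_gaps_values:
  "block_prob [1, 2, 1, 2, 1] = 2 / 135"
  "block_prob [1, 3, 1, 3, 1] = 862 / 225225"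
  "block_prob [1, 4, 1, 4, 1] = 362 / 637875"
  "block_prob [1, 5, 1, 5, 1] = 46996 / 834978375"
  "block_prob [1, 6, 1, 6, 1] = 862 / 212837625"
  "block_prob [1, 7, 1, 7, 1] = 510382 / 2292899734125"
  by (simp_all add: block_prob_rec up_to_four_block_values)

end

section \<open>Cyclic gaps of a finite set\<close>

text \<open>
  All natural numbers \<open>j\<close> are used as positions on the cycle, so that windows of consecutive positions need no
  case distinction; sites are numbered from \<open>1\<close>.
\<close>

definition site :: "nat \<Rightarrow> nat \<Rightarrow> nat" where
  "site K j = j mod K + 1"

lemma card_gaps_sorted_list:
  fixes l :: "nat list"
  assumes "sorted_wrt (<) l"
  shows "(\<Sum>j<length l - 1. of_bool (l ! Suc j - l ! j = g)) =
         card {a \<in> set l. 0 < g \<and> a + g \<in> set l \<and> (\<forall>d\<in>{0<..<g}. a + d \<notin> set l)}"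
  using assms
proof (induction l)
  case (Cons a l)
  show ?case
  proof (cases l)
    case (Cons b l')
    let ?S = "\<lambda>l. {a \<in> set l. 0 < g \<and> a + g \<in> set l \<and> (\<forall>d\<in>{0<..<g}. a + d \<notin> set l)}"
    have gt: "a < c" if "c \<in> set l" for c using Cons.prems that by auto
    have b: "b \<in> set l" "\<And>c. c \<in> set l \<Longrightarrow> b \<le> c" "a < b" using Cons.prems Cons by (auto intro: less_imp_le)
    have S: "?S (a # l) = (if b - a = g then insert a (?S l) else ?S l)"
    proof -
      have *: "A = (if P then insert a B else B)"
        if "a \<in> A \<longleftrightarrow> P" "\<And>c. c \<noteq> a \<Longrightarrow> c \<in> A \<longleftrightarrow> c \<in> B" "a \<notin> B" for A B P
        using that by (intro set_eqI) (metis insert_iff)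
      have "a \<in> ?S (a # l) \<longleftrightarrow> b - a = g"
      proof
        assume "a \<in> ?S (a # l)"
        then have g: "0 < g" "a + g \<in> set l" "\<forall>d\<in>{0<..<g}. a + d \<notin> set l" by auto
        show "b - a = g"
        proof (rule ccontr)
          assume "b - a \<noteq> g"
          then have "b - a \<in> {0<..<g}" using b(2)[OF g(2)] b(3) by auto
          then have "a + (b - a) \<notin> set l" using g(3) by blast
          then show False using b by simp
        qed
      next
        assume "b - a = g"
        moreover have "a + (b - a) = b" using b by simp
        moreover have "a + d \<notin> set l" if "d < b - a" for d using b(2)[of "a + d"] that by auto
        ultimately show "a \<in> ?S (a # l)" using b gt by auto
      qed
      moreover have "c \<in> ?S (a # l) \<longleftrightarrow> c \<in> ?S l" if "c \<noteq> a" for c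
        using that gt[of c] gt[of "c + g"] gt by auto
      moreover have "a \<notin> ?S l" using gt by auto
      ultimately show ?thesis by (rule *)
    qed
    have "card (?S (a # l)) = of_bool (b - a = g) + card (?S l)"
      unfolding S using gt by (auto simp: card_insert_if)
    moreover have "(\<Sum>j<length (a # l) - 1. of_bool ((a # l) ! Suc j - (a # l) ! j = g)) =
       of_bool (b - a = g) + (\<Sum>j<length l - 1. of_bool (l ! Suc j - l ! j = g) :: nat)"
      by (simp add: Cons sum.lessThan_Suc_shift del: sum.lessThan_Suc)
    moreover have "sorted_wrt (<) l" using Cons.prems by simp
    note Cons.IH[OF this]
    ultimately show ?thesis by (simp only:)
  qed auto
qed auto

text \<open>
  Appending a copy of the smallest element, shifted by one period, turns the wrap-around gap into an
  ordinary gap of a sorted list.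
\<close>

lemma cyclic_gaps_sorted_list:
  assumes R: "R \<subseteq> {1..K}" "R \<noteq> {}" and g: "0 < g" "g < K"
  defines "l \<equiv> sorted_list_of_set R"
  shows "(\<Sum>j<card R - 1. of_bool (l ! Suc j - l ! j = g) :: nat) +
           of_bool (l ! (card R - 1) - l ! 0 = K - g) =
         (\<Sum>k<K. of_bool (site K k \<in> R \<and> site K (k + g) \<in> R \<and> (\<forall>d\<in>{0<..<g}. site K (k + d) \<notin> R)))"
proof -
  have fin: "finite R" using R(1) finite_subset by blast
  have l: "set l = R" "length l = card R" "sorted_wrt (<) l" "l \<noteq> []"
    using fin R(2) by (auto simp: l_def)
  define m where "m = hd l"
  have m: "m \<in> R" "\<And>c. c \<in> R \<Longrightarrow> m \<le> c"
    using l by (cases l; auto simp: m_def)+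
  have m1: "1 \<le> m" "m \<le> K" using m(1) R(1) by auto
  define l' where "l' = l @ [m + K]"
  have sl': "sorted_wrt (<) l'"
    using l R(1) m1 by (auto simp: l'_def sorted_wrt_append)
  have last_in: "l ! (card R - 1) \<in> R" using l by (metis diff_less length_greater_0_conv nth_mem zero_less_one)
  have l0: "l ! 0 = m" using l by (simp add: m_def hd_conv_nth)
  have wrap: "(l ! (card R - 1) - l ! 0 = K - g) \<longleftrightarrow> (m + K - l ! (card R - 1) = g)"
    using m(2)[OF last_in] last_in R(1) g l0 by auto
  \<comment> \<open>\<open>?R'\<close> is the extended list as a set, \<open>?R''\<close> two periods of the periodic set; they
    have the same gaps starting in \<open>R\<close>, because no element of the second period lies below
    \<open>m + K\<close>.\<close>
  let ?R' = "R \<union> {m + K}"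
  let ?R'' = "R \<union> (\<lambda>a. a + K) ` R"
  have "(\<Sum>j<card R - 1. of_bool (l ! Suc j - l ! j = g) :: nat) +
           of_bool (l ! (card R - 1) - l ! 0 = K - g) =
        (\<Sum>j<Suc (card R - 1). of_bool (l' ! Suc j - l' ! j = g))"
  proof -
    have "card R > 0" using fin R(2) by (simp add: card_gt_0_iff)
    then have "(\<Sum>j<card R - 1. of_bool (l' ! Suc j - l' ! j = g)) =
               (\<Sum>j<card R - 1. of_bool (l ! Suc j - l ! j = g) :: nat)"
      using l by (intro sum.cong) (auto simp: l'_def nth_append)
    moreover have "l' ! Suc (card R - 1) = m + K" "l' ! (card R - 1) = l ! (card R - 1)"
      using l \<open>card R > 0\<close> by (auto simp: l'_def nth_append)
    ultimately show ?thesis by (simp only: sum.lessThan_Suc wrap)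
  qed
  also have "\<dots> = (\<Sum>j<length l' - 1. of_bool (l' ! Suc j - l' ! j = g))"
    using l R(2) fin by (simp add: l'_def card_gt_0_iff)
  also have "\<dots> = card {a \<in> ?R'. 0 < g \<and> a + g \<in> ?R' \<and> (\<forall>d\<in>{0<..<g}. a + d \<notin> ?R')}"
    by (subst card_gaps_sorted_list[OF sl']) (simp add: l'_def l)
  also have "{a \<in> ?R'. 0 < g \<and> a + g \<in> ?R' \<and> (\<forall>d\<in>{0<..<g}. a + d \<notin> ?R')} =
             {a \<in> R. a + g \<in> ?R'' \<and> (\<forall>d\<in>{0<..<g}. a + d \<notin> ?R'')}"
  proof (intro set_eqI iffI)
    fix a assume a: "a \<in> {a \<in> ?R'. 0 < g \<and> a + g \<in> ?R' \<and> (\<forall>d\<in>{0<..<g}. a + d \<notin> ?R')}"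
    then have aR: "a \<in> R" using R(1) m1 g by auto
    have "a + d \<notin> ?R''" if d: "d \<in> {0<..<g}" for d
    proof
      assume "a + d \<in> ?R''"
      then obtain c where c: "c \<in> R" "a + d = c + K" using a d by auto
      have "m + K - a \<in> {0<..<g}" using m(2)[OF c(1)] c(2) d aR R(1) m1 by auto
      then have "a + (m + K - a) \<notin> ?R'" using a by blast
      then show False using aR R(1) m1 by auto
    qed
    then show "a \<in> {a \<in> R. a + g \<in> ?R'' \<and> (\<forall>d\<in>{0<..<g}. a + d \<notin> ?R'')}"
      using a aR m(1) by auto
  next
    fix a assume a: "a \<in> {a \<in> R. a + g \<in> ?R'' \<and> (\<forall>d\<in>{0<..<g}. a + d \<notin> ?R'')}"
    have "a + g \<in> ?R'"
    proof (rule ccontr)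
      assume "a + g \<notin> ?R'"
      then obtain c where c: "c \<in> R" "a + g = c + K" "c \<noteq> m" using a by auto
      moreover have "a \<le> K" using a R(1) by auto
      moreover have "m < c" using m(2)[OF c(1)] c(3) by simp
      ultimately have "m + K - a \<in> {0<..<g}" using m1 by auto
      moreover have "a + (m + K - a) \<in> ?R''" using a R(1) m1 m(1) by auto
      ultimately show False using a by blast
    qed
    then show "a \<in> {a \<in> ?R'. 0 < g \<and> a + g \<in> ?R' \<and> (\<forall>d\<in>{0<..<g}. a + d \<notin> ?R')}"
      using a m(1) g by auto
  qed
  also have "card \<dots> = card {k \<in> {..<K}. site K k \<in> R \<and> site K (k + g) \<in> R \<and>
                              (\<forall>d\<in>{0<..<g}. site K (k + d) \<notin> R)}"
  proof (rule bij_betw_same_card[symmetric], rule bij_betw_imageI[where f = Suc])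
    have site: "site K (k + d) \<in> R \<longleftrightarrow> Suc k + d \<in> ?R''" if "k < K" "d \<le> g" for k d
    proof (cases "k + d < K")
      case True
      then show ?thesis using R(1) by (force simp: site_def)
    next
      case False
      then have "(k + d) mod K = k + d - K" using that g by (simp add: mod_if)
      moreover have "Suc k + d \<notin> R" using False R(1) by auto
      moreover have "Suc k + d \<in> (\<lambda>a. a + K) ` R \<longleftrightarrow> Suc (k + d - K) \<in> R"
      proof
        assume "Suc k + d \<in> (\<lambda>a. a + K) ` R"
        then obtain a where a: "a \<in> R" "Suc k + d = a + K" by auto
        then have "Suc (k + d - K) = a" using False by linarith
        then show "Suc (k + d - K) \<in> R" using a by simp
      next
        assume "Suc (k + d - K) \<in> R"
        then show "Suc k + d \<in> (\<lambda>a. a + K) ` R"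
          using False by (intro image_eqI[of _ _ "Suc (k + d - K)"]) auto
      qed
      ultimately show ?thesis by (simp add: site_def)
    qed
    have iff: "site K k \<in> R \<and> site K (k + g) \<in> R \<and> (\<forall>d\<in>{0<..<g}. site K (k + d) \<notin> R) \<longleftrightarrow>
          Suc k \<in> R \<and> Suc k + g \<in> ?R'' \<and> (\<forall>d\<in>{0<..<g}. Suc k + d \<notin> ?R'')" if k: "k < K" for k
    proof -
      have "site K k \<in> R \<longleftrightarrow> Suc k \<in> R" using k by (simp add: site_def)
      then show ?thesis using site[OF k] by simp
    qed
    show "Suc ` {k \<in> {..<K}. site K k \<in> R \<and> site K (k + g) \<in> R \<and>
                              (\<forall>d\<in>{0<..<g}. site K (k + d) \<notin> R)} =
          {a \<in> R. a + g \<in> ?R'' \<and> (\<forall>d\<in>{0<..<g}. a + d \<notin> ?R'')}"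
    proof (intro set_eqI iffI)
      fix a assume a: "a \<in> {a \<in> R. a + g \<in> ?R'' \<and> (\<forall>d\<in>{0<..<g}. a + d \<notin> ?R'')}"
      then obtain k where "a = Suc k" "k < K" using R(1) by (cases a) auto
      then show "a \<in> Suc ` {k \<in> {..<K}. site K k \<in> R \<and> site K (k + g) \<in> R \<and>
                              (\<forall>d\<in>{0<..<g}. site K (k + d) \<notin> R)}"
        using a iff by blast
    qed (use iff in blast)
  qed simp
  also have "\<dots> = (\<Sum>k<K. of_bool (site K k \<in> R \<and> site K (k + g) \<in> R \<and>
                              (\<forall>d\<in>{0<..<g}. site K (k + d) \<notin> R)))"
    by (simp add: of_bool_def sum.If_cases Int_def)
  finally show ?thesis .
qed

lemma gap_count_eq:
  assumes "roots K x \<noteq> {}" "i + 1 < K"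
  shows "gap_count i K x = (\<Sum>k<K. of_bool (site K k \<in> roots K x \<and> site K (k + (i + 1)) \<in> roots K x \<and>
            (\<forall>d\<in>{0<..<i + 1}. site K (k + d) \<notin> roots K x)))"
proof -
  have "(\<Sum>j = 1..num_roots K x - 1. of_bool (root_loc K x (j + 1) - root_loc K x j = i + 1)) =
        (\<Sum>j<card (roots K x) - 1. of_bool (sorted_list_of_set (roots K x) ! Suc j -
            sorted_list_of_set (roots K x) ! j = i + 1) :: nat)"
    unfolding num_roots_def root_loc_def
    by (rule sum.reindex_bij_witness[of _ Suc "\<lambda>j. j - 1"]) auto
  then show ?thesis
    unfolding gap_count_def
    by (subst cyclic_gaps_sorted_list[symmetric]) (use assms in \<open>auto simp: roots_def num_roots_def root_loc_def\<close>)
qed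

section \<open>Patterns of roots on the cycle\<close>

text \<open>
  For the order of first arrivals, this says that the site at position \<open>j\<close> is a root. The left
  neighbour is written \<open>j + (K - 1)\<close> instead of \<open>j - 1\<close>, which is also right at \<open>j = 0\<close>.
\<close>

definition root_at :: "nat \<Rightarrow> nat list \<Rightarrow> nat \<Rightarrow> bool" where
  "root_at K xs j \<longleftrightarrow> precedes xs (site K j) (site K (j + (K - 1))) \<and> precedes xs (site K j) (site K (j + 1))"

definition gap_at :: "nat \<Rightarrow> nat \<Rightarrow> nat \<Rightarrow> nat list \<Rightarrow> bool" where
  "gap_at K i k xs \<longleftrightarrow> root_at K xs k \<and> root_at K xs (k + (i + 1)) \<and>
     (\<forall>d\<in>{0<..<i + 1}. \<not> root_at K xs (k + d))"

lemma site_mod: "site K (j mod K + a) = site K (j + a)"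
  by (simp add: site_def mod_simps)

lemma root_at_mod: "root_at K xs (j mod K + a) = root_at K xs (j + a)"
  by (simp add: root_at_def site_mod add.assoc del: add_Suc_right)

text \<open>
  Positions may thus be moved by a period, in particular away from \<open>0\<close>.
\<close>

lemma gap_at_mod: "gap_at K i (k mod K) xs = gap_at K i k xs"
  using root_at_mod[of K xs k 0] by (simp add: gap_at_def root_at_mod del: add_Suc_right)

lemma gap_at_add_K: "gap_at K i (k + K) xs = gap_at K i k xs"
  by (metis gap_at_mod mod_add_self2)

lemma root_at_Suc:
  "K > 0 \<Longrightarrow> root_at K xs (Suc j) \<longleftrightarrow>
     precedes xs (site K (Suc j)) (site K j) \<and> precedes xs (site K (Suc j)) (site K (Suc (Suc j)))"
  by (simp add: root_at_def site_def)

text \<open>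
  Within one period, distinct positions are distinct sites.
\<close>

lemma inj_on_site: "inj_on (site K) {k..<k + K}"
proof (rule inj_onI)
  fix a b assume ab: "a \<in> {k..<k + K}" "b \<in> {k..<k + K}" "site K a = site K b"
  have *: "x = y" if "x \<le> y" "y < x + K" "x mod K = y mod K" for x y :: nat
  proof -
    have "K dvd y - x" using that by (metis mod_eq_dvd_iff_nat)
    then show ?thesis using that by (auto dest!: dvd_imp_le)
  qed
  show "a = b"
    using *[of a b] *[of b a] ab by (cases "a \<le> b") (auto simp: site_def)
qed

lemma site_in: "K > 0 \<Longrightarrow> site K j \<in> {1..K}"
  by (simp add: site_def Suc_leI)

lemma not_adjacent_roots:
  assumes "K > 1" "root_at K xs (Suc j)"
  shows "\<not> root_at K xs (Suc (Suc j))"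
proof
  assume "root_at K xs (Suc (Suc j))"
  then have "site K (Suc j) = site K (Suc (Suc j))"
    using assms by (auto simp: root_at_Suc intro: precedes_antisym)
  then have "Suc j = Suc (Suc j)"
    using inj_on_site[of K "Suc j"] assms by (auto dest!: inj_onD)
  then show False by simp
qed

lemma minima_at_upt:
  "minima_at V (map s [k..<k + n + 2]) xs \<longleftrightarrow>
     (\<forall>j<n. s (Suc (k + j)) \<in> V \<longleftrightarrow> precedes xs (s (Suc (k + j))) (s (k + j)) \<and>
        precedes xs (s (Suc (k + j))) (s (Suc (Suc (k + j)))))"
proof (induction n arbitrary: k)
  case 0
  then show ?case by (simp add: upt_conv_Cons numeral_2_eq_2)
next
  case (Suc n)
  have "[k..<k + Suc n + 2] = k # Suc k # Suc (Suc k) # [Suc (Suc (Suc k))..<k + Suc n + 2]"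
    by (simp add: upt_conv_Cons)
  moreover have "[Suc k..<Suc k + n + 2] = Suc k # Suc (Suc k) # [Suc (Suc (Suc k))..<k + Suc n + 2]"
    by (simp add: upt_conv_Cons)
  ultimately show ?case using Suc.IH[of "Suc k"] by (simp add: All_less_Suc2 del: upt_Suc)
qed

text \<open>
  The positions \<open>k + 1, \<dots>, k + n\<close> together with the position on either side, whose arrivals are needed
  to decide whether the first and the last of them are roots.
\<close>

definition window :: "nat \<Rightarrow> nat \<Rightarrow> nat \<Rightarrow> nat list" where
  "window K k n = map (site K) [k..<k + n + 2]"

definition window_marks :: "nat \<Rightarrow> nat \<Rightarrow> nat set \<Rightarrow> nat set" where
  "window_marks K k J = (\<lambda>j. site K (Suc (k + j))) ` J"

lemma site_eq_in_window:
  assumes "n + 2 \<le> K" "a < n + 2" "b < n + 2"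
  shows "site K (k + a) = site K (k + b) \<longleftrightarrow> a = b"
  using inj_onD[OF inj_on_site[of K k], of "k + a" "k + b"] assms by auto

lemma window_marks_iff:
  assumes "n + 2 \<le> K" "J \<subseteq> {..<n}" "a < n + 2"
  shows "site K (k + a) \<in> window_marks K k J \<longleftrightarrow> (\<exists>j\<in>J. a = Suc j)"
proof -
  have "site K (k + a) = site K (Suc (k + j)) \<longleftrightarrow> a = Suc j" if "j \<in> J" for j
    using site_eq_in_window[OF assms(1) assms(3), of "Suc j" k] assms(2) that by auto
  then show ?thesis by (auto simp: window_marks_def)
qed

lemma roots_pattern_iff:
  assumes "n + 2 \<le> K" "J \<subseteq> {..<n}"
  shows "(\<forall>j<n. root_at K xs (Suc (k + j)) \<longleftrightarrow> j \<in> J) \<longleftrightarrow>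
         minima_at (window_marks K k J) (window K k n) xs"
proof -
  have "site K (Suc (k + j)) \<in> window_marks K k J \<longleftrightarrow> j \<in> J" if "j < n" for j
    using window_marks_iff[OF assms, of "Suc j" k] that by auto
  then show ?thesis
    unfolding window_def minima_at_upt using assms by (auto simp: root_at_Suc)
qed

text \<open>
  A prescription of all the roots in a window is a prescription of local minima along a path, so its
  probability is given by \<open>word_prob\<close>.
\<close>

lemma prob_roots_pattern:
  assumes "n + 2 \<le> K" "J \<subseteq> {..<n}"
  shows "measure_pmf.prob (random_order {1..K}) {xs. \<forall>j<n. root_at K xs (Suc (k + j)) \<longleftrightarrow> j \<in> J} =
         word_prob (False # map (\<lambda>j. j \<in> J) [0..<n] @ [False])" (is "?l = ?r")
    and "measure_pmf.prob (random_order (set (window K k n)))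
           {xs. minima_at (window_marks K k J) (window K k n) xs} =
         word_prob (False # map (\<lambda>j. j \<in> J) [0..<n] @ [False])"
proof -
  have marks: "map (\<lambda>x. x \<in> window_marks K k J) (window K k n) =
               False # map (\<lambda>j. j \<in> J) [0..<n] @ [False]" (is "?L = ?R")
  proof (rule nth_equalityI)
    fix a assume "a < length ?L"
    then have a: "a < n + 2" by (simp add: window_def)
    then have "?L ! a \<longleftrightarrow> (\<exists>j\<in>J. a = Suc j)"
      using window_marks_iff[OF assms a, of k] by (simp add: window_def del: upt_Suc)
    also have "\<dots> \<longleftrightarrow> ?R ! a"
      using a assms(2) by (cases a) (auto simp: nth_append)
    finally show "?L ! a = ?R ! a" .
  qed (simp add: window_def)
  have "distinct (window K k n)"
    unfolding window_def distinct_map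
    using inj_on_subset[OF inj_on_site[of K k], of "set [k..<k + n + 2]"] assms(1) by auto
  moreover have ne: "window K k n \<noteq> []" by (simp add: window_def)
  moreover have "hd (window K k n) \<notin> window_marks K k J"
    using arg_cong[OF marks, of hd] ne by (simp add: hd_map)
  moreover have "last (window K k n) \<notin> window_marks K k J"
    using arg_cong[OF marks, of last] ne by (simp add: last_map)
  ultimately show *: "measure_pmf.prob (random_order (set (window K k n)))
           {xs. minima_at (window_marks K k J) (window K k n) xs} = ?r"
    using prob_minima_at[of "window K k n" "window_marks K k J"] by (simp add: marks)
  have "set (window K k n) \<subseteq> {1..K}"
    using site_in[of K] assms(1) by (auto simp: window_def)
  then show "?l = ?r"
    unfolding roots_pattern_iff[OF assms] using * by (subst prob_minima_at_restrict) auto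
qed

text \<open>
  Patterns in two windows without a common site, on either way around the cycle, are independent.
\<close>

lemma prob_disjoint_roots_patterns:
  assumes "n + 2 \<le> d" "d + n + 2 \<le> K" "J \<subseteq> {..<n}"
  shows "measure_pmf.prob (random_order {1..K})
           {xs. (\<forall>j<n. root_at K xs (Suc (k + j)) \<longleftrightarrow> j \<in> J) \<and>
                (\<forall>j<n. root_at K xs (Suc (k + d + j)) \<longleftrightarrow> j \<in> J)} =
         (word_prob (False # map (\<lambda>j. j \<in> J) [0..<n] @ [False]))\<^sup>2"
proof -
  have le: "n + 2 \<le> K" using assms by simp
  have sub: "set (window K k' n) \<subseteq> {1..K}" for k'
    using site_in[of K] assms(2) by (auto simp: window_def)
  have disj: "set (window K k n) \<inter> set (window K (k + d) n) = {}"
  proof -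
    have "site K a \<noteq> site K b" if "a \<in> {k..<k + n + 2}" "b \<in> {k + d..<k + d + n + 2}" for a b
      using inj_onD[OF inj_on_site[of K k], of a b] that assms by auto
    then show ?thesis by (auto simp: window_def simp del: upt_Suc)
  qed
  show ?thesis
    unfolding roots_pattern_iff[OF le assms(3)]
    by (subst prob_minima_at_disjoint[OF _ sub sub disj])
      (simp_all add: prob_roots_pattern(2)[OF le assms(3)] power2_eq_square)
qed

section \<open>Mean and variance of the number of gaps\<close>

text \<open>
  The probabilities of a gap of \<open>i\<close> sites at a given place, of two such gaps with a common root, and of
  two such gaps with exactly one site between the second root of one and the first root of the other.
\<close>

definition gap_prob :: "nat \<Rightarrow> real" where
  "gap_prob i = block_prob [1, i, 1]"
definition adjacent_gaps_prob :: "nat \<Rightarrow> real" where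
  "adjacent_gaps_prob i = block_prob [1, i, i, 1]"
definition separated_gaps_prob :: "nat \<Rightarrow> real" where
  "separated_gaps_prob i = block_prob [1, i, 1, i, 1]"

text \<open>
  By periodicity, the position of a root may be assumed to be a successor, as in \<open>prob_roots_pattern\<close>.
\<close>

lemma gap_at_shift: "K > 0 \<Longrightarrow> \<exists>k'. \<forall>d xs. gap_at K i (k + d) xs = gap_at K i (Suc (k' + d)) xs"
proof (intro exI allI)
  fix d xs assume "K > 0"
  then have "Suc (k + K - 1 + d) = k + d + K" by simp
  then show "gap_at K i (k + d) xs = gap_at K i (Suc (k + K - 1 + d)) xs"
    using gap_at_add_K[of K i "k + d" xs] by (simp only:)
qed

lemma gap_pattern:
  fixes r :: "nat \<Rightarrow> bool"
  shows "r 0 \<and> r (i + 1) \<and> (\<forall>d\<in>{0<..<i + 1}. \<not> r d) \<longleftrightarrow> (\<forall>j<i + 2. r j \<longleftrightarrow> j \<in> {0, i + 1})"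
proof (rule iffI, rule allI, rule impI)
  fix j assume "r 0 \<and> r (i + 1) \<and> (\<forall>d\<in>{0<..<i + 1}. \<not> r d)" "j < i + 2"
  moreover from this have "j = 0 \<or> j = i + 1 \<or> j \<in> {0<..<i + 1}" by auto
  ultimately show "r j \<longleftrightarrow> j \<in> {0, i + 1}" by auto
qed auto

lemma gap_at_Suc: "gap_at K i (Suc k) xs \<longleftrightarrow> (\<forall>j<i + 2. root_at K xs (Suc (k + j)) \<longleftrightarrow> j \<in> {0, i + 1})"
  unfolding gap_pattern[symmetric] by (simp add: gap_at_def)

text \<open>
  Two overlapping gap patterns amount to one pattern on the union of their windows. At offset \<open>i + 1\<close>
  the windows prescribe every position of the union.
\<close>

lemma adjacent_gaps_pattern:
  fixes r :: "nat \<Rightarrow> bool"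
  shows "(\<forall>j<i + 2. r j \<longleftrightarrow> j \<in> {0, i + 1}) \<and> (\<forall>j<i + 2. r (i + 1 + j) \<longleftrightarrow> j \<in> {0, i + 1}) \<longleftrightarrow>
         (\<forall>j<2 * i + 3. r j \<longleftrightarrow> j \<in> {0, i + 1, 2 * i + 2})" (is "?A \<and> ?B \<longleftrightarrow> ?C")
proof
  assume AB: "?A \<and> ?B"
  show ?C
  proof (rule allI, rule impI)
    fix j assume j: "j < 2 * i + 3"
    show "r j \<longleftrightarrow> j \<in> {0, i + 1, 2 * i + 2}"
    proof (cases "j < i + 2")
      case False
      then have "j = i + 1 + (j - (i + 1))" "j - (i + 1) < i + 2" using j by auto
      then have "r j \<longleftrightarrow> j - (i + 1) \<in> {0, i + 1}" using AB by metis
      then show ?thesis using False by auto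
    qed (use AB in auto)
  qed
next
  assume C: ?C
  have ?B
  proof (rule allI, rule impI)
    fix j assume j: "j < i + 2"
    show "r (i + 1 + j) \<longleftrightarrow> j \<in> {0, i + 1}"
      using C[rule_format, of "i + 1 + j"] j by auto
  qed
  moreover have ?A using C by auto
  ultimately show "?A \<and> ?B" by simp
qed

text \<open>
  At offset \<open>i + 3\<close> neither window prescribes the position \<open>i + 2\<close> in the middle; it is not a root
  since its neighbour is one.
\<close>

lemma separated_gaps_pattern:
  fixes r :: "nat \<Rightarrow> bool"
  assumes "\<And>j. r j \<Longrightarrow> \<not> r (Suc j)"
  shows "(\<forall>j<i + 2. r j \<longleftrightarrow> j \<in> {0, i + 1}) \<and> (\<forall>j<i + 2. r (i + 3 + j) \<longleftrightarrow> j \<in> {0, i + 1}) \<longleftrightarrow>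
         (\<forall>j<2 * i + 5. r j \<longleftrightarrow> j \<in> {0, i + 1, i + 3, 2 * i + 4})" (is "?A \<and> ?B \<longleftrightarrow> ?C")
proof
  assume AB: "?A \<and> ?B"
  show ?C
  proof (rule allI, rule impI)
    fix j assume j: "j < 2 * i + 5"
    consider "j < i + 2" | "j = i + 2" | "j \<ge> i + 3" by linarith
    then show "r j \<longleftrightarrow> j \<in> {0, i + 1, i + 3, 2 * i + 4}"
    proof cases
      case 2
      have "r (i + 1)" using AB by auto
      then show ?thesis using assms[of "i + 1"] 2 by simp
    next
      case 3
      then have "j = i + 3 + (j - (i + 3))" "j - (i + 3) < i + 2" using j by auto
      then have "r j \<longleftrightarrow> j - (i + 3) \<in> {0, i + 1}" using AB by metis
      then show ?thesis using 3 by auto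
    qed (use AB in auto)
  qed
next
  assume C: ?C
  have ?B
  proof (rule allI, rule impI)
    fix j assume j: "j < i + 2"
    show "r (i + 3 + j) \<longleftrightarrow> j \<in> {0, i + 1}"
      using C[rule_format, of "i + 3 + j"] j by auto
  qed
  moreover have ?A using C by auto
  ultimately show "?A \<and> ?B" by simp
qed

lemma prob_gap_at:
  assumes "i + 4 \<le> K"
  shows "measure_pmf.prob (random_order {1..K}) {xs. gap_at K i k xs} = gap_prob i"
proof -
  obtain k' where "\<forall>d xs. gap_at K i (k + d) xs = gap_at K i (Suc (k' + d)) xs"
    using gap_at_shift[of K i k] assms by auto
  from spec[OF this, of 0] have k': "gap_at K i k xs = gap_at K i (Suc k') xs" for xs by simp
  have word: "False # map (\<lambda>j. j \<in> {0, i + 1}) [0..<i + 2] @ [False] = block_word [1, i, 1]"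
    by (rule nth_equalityI) (auto simp: nth_append nth_Cons' simp del: upt_Suc)
  show ?thesis
    unfolding k' gap_at_Suc
    using prob_roots_pattern(1)[of "i + 2" K "{0, i + 1}" k'] assms
    unfolding word by (simp add: gap_prob_def block_prob_def del: block_word.simps)
qed

text \<open>
  A second gap at offset \<open>d\<close> from a given one is impossible if its first root would lie inside the given
  gap (\<open>0 < d \<le> i\<close>) or next to the second root of that gap (\<open>d = i + 2\<close>). It shares a root with the
  given gap if \<open>d = i + 1\<close>; if \<open>d = i + 3\<close>, the two windows overlap in one site, and from
  \<open>d = i + 4\<close> on they are disjoint and the two gaps are independent.
\<close>

lemma prob_gap_at_pair:
  assumes "1 \<le> i" "2 * i + 7 \<le> K" "d + i + 4 \<le> K"
  shows "measure_pmf.prob (random_order {1..K}) {xs. gap_at K i k xs \<and> gap_at K i (k + d) xs} =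
    (if d = 0 then gap_prob i else if d = i + 1 then adjacent_gaps_prob i
     else if d = i + 3 then separated_gaps_prob i else if d < i + 4 then 0 else (gap_prob i)\<^sup>2)"
proof -
  obtain k' where "\<forall>d xs. gap_at K i (k + d) xs = gap_at K i (Suc (k' + d)) xs"
    using gap_at_shift[of K i k] assms by auto
  then have k': "gap_at K i (k + d) xs = gap_at K i (Suc (k' + d)) xs" for d xs by blast
  have k0: "gap_at K i k xs = gap_at K i (Suc k') xs" for xs using k'[of 0] by simp
  let ?r = "\<lambda>xs j. root_at K xs (Suc (k' + j))"
  have both: "gap_at K i k xs \<and> gap_at K i (k + d) xs \<longleftrightarrow>
       (\<forall>j<i + 2. ?r xs j \<longleftrightarrow> j \<in> {0, i + 1}) \<and> (\<forall>j<i + 2. ?r xs (d + j) \<longleftrightarrow> j \<in> {0, i + 1})" for xs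
    unfolding k0 k' gap_at_Suc by (simp only: add.assoc)
  consider "d = 0" | "d = i + 1" | "d = i + 3" | "0 < d" "d \<noteq> i + 1" "d < i + 3" | "i + 4 \<le> d"
    by linarith
  then show ?thesis
  proof cases
    case 1
    then show ?thesis using prob_gap_at[of i K k] assms by simp
  next
    case 2
    have word: "False # map (\<lambda>j. j \<in> {0, i + 1, 2 * i + 2}) [0..<2 * i + 3] @ [False] = block_word [1, i, i, 1]"
      by (rule nth_equalityI) (auto simp: nth_append nth_Cons' simp del: upt_Suc)
    have pattern: "gap_at K i k xs \<and> gap_at K i (k + d) xs \<longleftrightarrow>
        (\<forall>j<2 * i + 3. ?r xs j \<longleftrightarrow> j \<in> {0, i + 1, 2 * i + 2})" for xs
      unfolding both unfolding 2 by (rule adjacent_gaps_pattern)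
    show ?thesis
      unfolding pattern unfolding 2
      using prob_roots_pattern(1)[of "2 * i + 3" K "{0, i + 1, 2 * i + 2}" k'] assms
      unfolding word by (simp add: adjacent_gaps_prob_def block_prob_def del: block_word.simps)
  next
    case 3
    have word: "False # map (\<lambda>j. j \<in> {0, i + 1, i + 3, 2 * i + 4}) [0..<2 * i + 5] @ [False] =
                block_word [1, i, 1, i, 1]"
      by (rule nth_equalityI) (auto simp: nth_append nth_Cons' simp del: upt_Suc)
    have sep: "?r xs j \<Longrightarrow> \<not> ?r xs (Suc j)" for xs j
      using not_adjacent_roots[of K xs "k' + j"] assms by simp
    have pattern: "gap_at K i k xs \<and> gap_at K i (k + d) xs \<longleftrightarrow>
        (\<forall>j<2 * i + 5. ?r xs j \<longleftrightarrow> j \<in> {0, i + 1, i + 3, 2 * i + 4})" for xs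
      unfolding both unfolding 3 by (rule separated_gaps_pattern) (rule sep)
    show ?thesis
      unfolding pattern unfolding 3
      using prob_roots_pattern(1)[of "2 * i + 5" K "{0, i + 1, i + 3, 2 * i + 4}" k'] assms
      unfolding word by (simp add: separated_gaps_prob_def block_prob_def del: block_word.simps)
  next
    case 4
    have "\<not> (gap_at K i k xs \<and> gap_at K i (k + d) xs)" for xs
    proof
      assume "gap_at K i k xs \<and> gap_at K i (k + d) xs"
      then have A: "\<forall>j<i + 2. ?r xs j \<longleftrightarrow> j \<in> {0, i + 1}" and B: "\<forall>j<i + 2. ?r xs (d + j) \<longleftrightarrow> j \<in> {0, i + 1}"
        unfolding both by auto
      have rd: "?r xs d" using spec[OF B, of 0] by simp
      show False
      proof (cases "d = i + 2")
        case True
        have "?r xs (i + 1)" using spec[OF A, of "i + 1"] by simp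
        then show False using not_adjacent_roots[of K xs "k' + (i + 1)"] rd assms True by simp
      next
        case False
        then show False using spec[OF A, of d] rd 4 by simp
      qed
    qed
    then have "{xs. gap_at K i k xs \<and> gap_at K i (k + d) xs} = {}" by blast
    then show ?thesis using 4 by (simp only: measure_empty) simp
  next
    case 5
    have word: "False # map (\<lambda>j. j \<in> {0, i + 1}) [0..<i + 2] @ [False] = block_word [1, i, 1]"
      by (rule nth_equalityI) (auto simp: nth_append nth_Cons' simp del: upt_Suc)
    have "measure_pmf.prob (random_order {1..K}) {xs. gap_at K i k xs \<and> gap_at K i (k + d) xs} = (gap_prob i)\<^sup>2"
      unfolding k0 k' gap_at_Suc
      using prob_disjoint_roots_patterns[of "i + 2" d K "{0, i + 1}" k'] assms 5
      unfolding word by (simp add: gap_prob_def block_prob_def add.assoc del: block_word.simps)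
    then show ?thesis using 5 by simp
  qed
qed

lemma sum_periodic_shift:
  fixes f :: "nat \<Rightarrow> real"
  assumes "\<And>j. f (j mod K) = f j" "K > 0"
  shows "(\<Sum>j<K. f j) = (\<Sum>d<K. f (k + d))"
proof -
  have "bij_betw (\<lambda>d. (k + d) mod K) {..<K} {..<K}"
  proof (rule bij_betwI')
    fix x y assume "x \<in> {..<K}" "y \<in> {..<K}"
    then show "(k + x) mod K = (k + y) mod K \<longleftrightarrow> x = y"
      using inj_onD[OF inj_on_site[of K k], of "k + x" "k + y"] by (auto simp: site_def)
  next
    fix y assume y: "y \<in> {..<K}"
    have "(k + (y + (K - k mod K)) mod K) mod K = (k mod K + (y + (K - k mod K))) mod K"
      by (simp add: mod_simps)
    also have "k mod K + (y + (K - k mod K)) = y + K"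
      using mod_less_divisor[OF assms(2), of k] by linarith
    also have "(y + K) mod K = y" using y by simp
    finally show "\<exists>x\<in>{..<K}. y = (k + x) mod K"
      using assms(2) by (intro bexI[of _ "(y + (K - k mod K)) mod K"]) auto
  qed (use assms(2) in auto)
  from sum.reindex_bij_betw[OF this, of f] show ?thesis by (simp add: assms(1))
qed

definition gaps :: "nat \<Rightarrow> nat \<Rightarrow> nat list \<Rightarrow> real" where
  "gaps K i xs = (\<Sum>k<K. of_bool (gap_at K i k xs))"

lemma finite_set_random_order: "finite A \<Longrightarrow> finite (set_pmf (random_order A))"
  by simp

lemma expectation_of_bool:
  "measure_pmf.expectation p (\<lambda>x. of_bool (P x) :: real) = measure_pmf.prob p {x. P x}"
proof -
  have "(\<lambda>x. of_bool (P x) :: real) = indicator {x. P x}" by (auto simp: fun_eq_iff)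
  then show ?thesis by simp
qed

lemma expectation_gaps:
  assumes "i + 4 \<le> K"
  shows "measure_pmf.expectation (random_order {1..K}) (gaps K i) = real K * gap_prob i"
proof -
  have "measure_pmf.expectation (random_order {1..K}) (gaps K i) =
        (\<Sum>k<K. measure_pmf.expectation (random_order {1..K}) (\<lambda>xs. of_bool (gap_at K i k xs)))"
    unfolding gaps_def
    by (intro Bochner_Integration.integral_sum integrable_measure_pmf_finite finite_set_random_order) simp
  then show ?thesis by (simp only: expectation_of_bool prob_gap_at[OF assms] sum_constant card_lessThan)
qed

text \<open>
  Expand the square into pairs of gaps. The offset of a pair matters only modulo \<open>K\<close> and up to sign, so
  each of the \<open>i + 3\<close> smallest nonzero offsets occurs twice, next to the offset \<open>0\<close>; the remaining
  \<open>K - (2 * i + 7)\<close> offsets give independent gaps.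
\<close>

lemma expectation_gaps_square:
  assumes "1 \<le> i" "2 * i + 7 \<le> K"
  shows "measure_pmf.expectation (random_order {1..K}) (\<lambda>xs. (gaps K i xs)\<^sup>2) =
    real K * (gap_prob i + 2 * adjacent_gaps_prob i + 2 * separated_gaps_prob i +
      (real K - (2 * real i + 7)) * (gap_prob i)\<^sup>2)"
proof -
  let ?P = "\<lambda>k l. measure_pmf.prob (random_order {1..K}) {xs. gap_at K i k xs \<and> gap_at K i l xs}"
  let ?p = "gap_prob i" and ?q = "adjacent_gaps_prob i" and ?s = "separated_gaps_prob i"
  define c where "c d = (if d = 0 then ?p else if d = i + 1 then ?q
     else if d = i + 3 then ?s else if d < i + 4 then 0 else ?p\<^sup>2)" for d
  have pair: "?P k (k + d) = c d" if "d + i + 4 \<le> K" for k d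
    using prob_gap_at_pair[OF assms that] by (simp add: c_def)
  \<comment> \<open>An offset \<open>K - e\<close> is the offset \<open>e\<close> as seen from the other gap.\<close>
  have wrap: "?P k (k + (K - e)) = c e" if "e < i + 4" for k e
  proof -
    have "k + (K - e) + e = k + K" using that assms by simp
    then have "gap_at K i (k + (K - e) + e) xs = gap_at K i k xs" for xs by (simp add: gap_at_add_K)
    then have "?P k (k + (K - e)) = ?P (k + (K - e)) (k + (K - e) + e)"
      by (simp add: conj_commute)
    then show ?thesis using pair[of e "k + (K - e)"] that assms by simp
  qed
  have small: "(\<Sum>d\<in>{1..<i + 4}. c d) = ?q + ?s"
  proof -
    have "(\<Sum>d\<in>{1..<i + 4}. c d) = (\<Sum>d\<in>{i + 1, i + 3}. c d)"
      by (rule sum.mono_neutral_right) (auto simp: c_def)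
    then show ?thesis by (simp add: c_def)
  qed
  have mid: "i + 4 \<le> K - (i + 3)" using assms by linarith
  have split: "(\<Sum>d<K. f d) = f 0 + (\<Sum>d\<in>{1..<i + 4}. f d) + (\<Sum>d\<in>{i + 4..<K - (i + 3)}. f d) +
      (\<Sum>d\<in>{K - (i + 3)..<K}. f d)" for f :: "nat \<Rightarrow> real"
    using sum.atLeastLessThan_concat[of 0 1 K f] sum.atLeastLessThan_concat[of 1 "i + 4" K f]
      sum.atLeastLessThan_concat[OF mid, of K f] assms
    by (simp add: atLeast0LessThan)
  have row: "(\<Sum>l<K. ?P k l) = ?p + 2 * ?q + 2 * ?s + (real K - (2 * real i + 7)) * ?p\<^sup>2" for k
  proof -
    have "(\<Sum>l<K. ?P k l) = (\<Sum>d<K. ?P k (k + d))"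
      using assms by (intro sum_periodic_shift) (simp_all add: gap_at_mod)
    also have "\<dots> = ?P k (k + 0) + (\<Sum>d\<in>{1..<i + 4}. ?P k (k + d)) +
       (\<Sum>d\<in>{i + 4..<K - (i + 3)}. ?P k (k + d)) + (\<Sum>d\<in>{K - (i + 3)..<K}. ?P k (k + d))"
      by (rule split)
    also have "?P k (k + 0) = ?p" using pair[of 0 k] assms by (simp add: c_def)
    also have "(\<Sum>d\<in>{1..<i + 4}. ?P k (k + d)) = (\<Sum>d\<in>{1..<i + 4}. c d)"
      using assms by (intro sum.cong pair) auto
    also have "(\<Sum>d\<in>{i + 4..<K - (i + 3)}. ?P k (k + d)) = (\<Sum>d\<in>{i + 4..<K - (i + 3)}. ?p\<^sup>2)"
      proof (intro sum.cong refl)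
      fix d assume "d \<in> {i + 4..<K - (i + 3)}"
      then show "?P k (k + d) = ?p\<^sup>2" using pair[of d k] by (auto simp: c_def)
    qed
    also have "(\<Sum>d\<in>{K - (i + 3)..<K}. ?P k (k + d)) = (\<Sum>e\<in>{1..<i + 4}. ?P k (k + (K - e)))"
      using assms by (intro sum.reindex_bij_witness[of _ "\<lambda>e. K - e" "\<lambda>d. K - d"]) auto
    also have "\<dots> = (\<Sum>e\<in>{1..<i + 4}. c e)"
      by (intro sum.cong wrap) auto
    finally show ?thesis
      using assms unfolding small by (simp add: of_nat_diff algebra_simps)
  qed
  have sq: "(gaps K i xs)\<^sup>2 = (\<Sum>k<K. \<Sum>l<K. of_bool (gap_at K i k xs \<and> gap_at K i l xs))" for xs
    by (simp only: gaps_def power2_eq_square sum_product of_bool_conj)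
  have "measure_pmf.expectation (random_order {1..K}) (\<lambda>xs. (gaps K i xs)\<^sup>2) = (\<Sum>k<K. \<Sum>l<K.
      measure_pmf.expectation (random_order {1..K}) (\<lambda>xs. of_bool (gap_at K i k xs \<and> gap_at K i l xs)))"
    unfolding sq
    by (subst Bochner_Integration.integral_sum, intro integrable_measure_pmf_finite finite_set_random_order, simp)
      (intro sum.cong refl Bochner_Integration.integral_sum integrable_measure_pmf_finite finite_set_random_order, simp)
  also have "\<dots> = (\<Sum>k<K. \<Sum>l<K. ?P k l)" by (simp only: expectation_of_bool)
  finally show ?thesis by (simp only: row sum_constant card_lessThan)
qed

text \<open>
  The terms of order \<open>K\<^sup>2\<close> cancel.
\<close>

lemma variance_gaps:
  assumes "1 \<le> i" "2 * i + 7 \<le> K"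
  shows "measure_pmf.variance (random_order {1..K}) (gaps K i) =
    real K * (gap_prob i + 2 * adjacent_gaps_prob i + 2 * separated_gaps_prob i -
      (2 * real i + 7) * (gap_prob i)\<^sup>2)"
proof -
  have "measure_pmf.variance (random_order {1..K}) (gaps K i) =
        measure_pmf.expectation (random_order {1..K}) (\<lambda>xs. (gaps K i xs)\<^sup>2) -
        (measure_pmf.expectation (random_order {1..K}) (gaps K i))\<^sup>2"
    by (intro measure_pmf.variance_eq integrable_measure_pmf_finite finite_set_random_order) simp_all
  moreover have "i + 4 \<le> K" using assms by simp
  ultimately have "measure_pmf.variance (random_order {1..K}) (gaps K i) =
      real K * (gap_prob i + 2 * adjacent_gaps_prob i + 2 * separated_gaps_prob i +
        (real K - (2 * real i + 7)) * (gap_prob i)\<^sup>2) - (real K * gap_prob i)\<^sup>2"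
    by (simp only: expectation_gaps expectation_gaps_square[OF assms])
  also have "\<dots> = real K * (gap_prob i + 2 * adjacent_gaps_prob i + 2 * separated_gaps_prob i -
      (2 * real i + 7) * (gap_prob i)\<^sup>2)"
    by (simp add: power2_eq_square algebra_simps)
  finally show ?thesis .
qed

section \<open>Roots and the order of first arrivals\<close>

definition arrival :: "(nat \<Rightarrow> nat) \<Rightarrow> nat \<Rightarrow> nat" where
  "arrival x k = (LEAST n. 1 \<le> n \<and> x n = k)"

text \<open>
  Arrival times are meaningful for paths in which every site is eventually hit; almost every path is
  of this kind.
\<close>

definition covers :: "nat \<Rightarrow> (nat \<Rightarrow> nat) \<Rightarrow> bool" where
  "covers K x \<longleftrightarrow> (\<forall>k\<in>{1..K}. \<exists>n\<ge>1. x n = k)"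

lemma arrival:
  assumes "covers K x" "k \<in> {1..K}"
  shows "1 \<le> arrival x k" "x (arrival x k) = k"
  using LeastI_ex[of "\<lambda>n. 1 \<le> n \<and> x n = k"] assms by (auto simp: arrival_def covers_def)

lemma not_hit_iff_arrival:
  assumes "covers K x" "k \<in> {1..K}"
  shows "(\<forall>m\<in>{1..n}. x m \<noteq> k) \<longleftrightarrow> n < arrival x k"
proof
  assume "\<forall>m\<in>{1..n}. x m \<noteq> k"
  then show "n < arrival x k" using arrival[OF assms] by (meson atLeastAtMost_iff not_le_imp_less)
next
  assume "n < arrival x k"
  show "\<forall>m\<in>{1..n}. x m \<noteq> k"
  proof
    fix m assume m: "m \<in> {1..n}"
    then have "m < arrival x k" using \<open>n < arrival x k\<close> by simp
    then show "x m \<noteq> k"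
      using not_less_Least[of m "\<lambda>n. 1 \<le> n \<and> x n = k"] m by (simp add: arrival_def)
  qed
qed

lemma arrival_inj:
  "covers K x \<Longrightarrow> a \<in> {1..K} \<Longrightarrow> b \<in> {1..K} \<Longrightarrow> arrival x a = arrival x b \<longleftrightarrow> a = b"
  using arrival(2) by metis

lemma height_eq_0_iff: "height K x n k = 0 \<longleftrightarrow> (\<forall>m\<in>{1..n}. x m \<noteq> k)"
  by (induction n) (auto simp: atLeastAtMostSuc_conv)

lemma nbrs_site:
  assumes "K \<ge> 3"
  shows "nbrs K (site K j) = {site K (j + (K - 1)), site K j, site K (j + 1)}"
proof -
  define m where "m = j mod K"
  have m: "m < K" using assms by (simp add: m_def)
  have "site K (j + (K - 1)) = site K (m + (K - 1))" "site K j = site K m" "site K (j + 1) = site K (m + 1)"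
    unfolding m_def using site_mod[of K j 0] site_mod[of K j "K - 1"] site_mod[of K j 1] by simp_all
  moreover have "nbrs K (site K m) = {site K (m + (K - 1)), site K m, site K (m + 1)}"
  proof -
    consider "m = 0" | "m = K - 1" "m \<noteq> 0" | "m \<noteq> 0" "m < K - 1" using m by linarith
    then show ?thesis
    proof cases
      case 3
      then have "(m + (K - 1)) mod K = m - 1"
        by (subst mod_if) auto
      then show ?thesis using 3 assms by (auto simp: nbrs_def site_def)
    next
      case 2
      then have "(m + (K - 1)) mod K = m - 1"
        using assms by (subst mod_if) auto
      then show ?thesis using 2 assms by (auto simp: nbrs_def site_def)
    qed (use assms in \<open>auto simp: nbrs_def site_def\<close>)
  qed
  ultimately show ?thesis by simp
qed

lemma height_mono:
  assumes "K \<ge> 3" "m \<le> n"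
  shows "height K x m (site K j) \<le> height K x n (site K j)"
proof (rule lift_Suc_mono_le[of "\<lambda>n. height K x n (site K j)", OF _ assms(2)])
  fix n
  have "height K x n (site K j) \<le> Max (height K x n ` nbrs K (site K j))"
    unfolding nbrs_site[OF assms(1)] by (intro Max_ge) auto
  then show "height K x n (site K j) \<le> height K x (Suc n) (site K j)" by auto
qed

text \<open>
  Heights never decrease, so whether a site is a root is decided by its height just after its first
  arrival. This height is \<open>1\<close> if and only if the neighbours still have height \<open>0\<close>.
\<close>

lemma site_in_roots_iff:
  assumes K: "K \<ge> 3" and cov: "covers K x"
  shows "site K j \<in> roots K x \<longleftrightarrow>
     arrival x (site K j) < arrival x (site K (j + (K - 1))) \<and>
     arrival x (site K j) < arrival x (site K (j + 1))"
proof -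
  have sites: "site K a \<in> {1..K}" for a using site_in[of K a] K by simp
  let ?k = "site K j"
  let ?N = "{site K (j + (K - 1)), ?k, site K (j + 1)}"
  have zero: "height K x n (site K a) = 0 \<longleftrightarrow> n < arrival x (site K a)" for n a
    by (simp only: height_eq_0_iff not_hit_iff_arrival[OF cov sites])
  define t where "t = arrival x ?k"
  obtain s where s: "t = Suc s" using arrival(1)[OF cov sites[of j]] by (cases t) (auto simp: t_def)
  have xt: "x (Suc s) = ?k" using arrival(2)[OF cov sites[of j]] s by (simp add: t_def)
  have "?k \<in> roots K x \<longleftrightarrow> (\<exists>i\<ge>1. height K x i ?k = 1)"
    using sites[of j] by (simp add: roots_def)
  also have "\<dots> \<longleftrightarrow> height K x t ?k = 1"
  proof
    assume "\<exists>i\<ge>1. height K x i ?k = 1"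
    then obtain i where i: "height K x i ?k = 1" by auto
    then have "t \<le> i" using zero[of i j] by (auto simp: t_def)
    then have "height K x t ?k \<le> 1" using height_mono[OF K, of t i x j] i by simp
    moreover have "height K x t ?k \<noteq> 0" using zero[of t j] by (simp add: t_def)
    ultimately show "height K x t ?k = 1" by simp
  qed (use s in auto)
  also have "\<dots> \<longleftrightarrow> Max (height K x s ` ?N) = 0"
    using xt unfolding s by (simp add: nbrs_site[OF K])
  also have "\<dots> \<longleftrightarrow> (\<forall>k\<in>?N. height K x s k = 0)"
    by auto
  also have "\<dots> \<longleftrightarrow> (\<forall>k\<in>?N. t \<le> arrival x k)"
    by (auto simp: zero s)
  also have "\<dots> \<longleftrightarrow> t < arrival x (site K (j + (K - 1))) \<and> t < arrival x (site K (j + 1))"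
  proof -
    have "site K (j + a) \<noteq> ?k" if "0 < a" "a < K" for a
      using inj_onD[OF inj_on_site[of K j], of "j + a" j] that by auto
    then have "arrival x (site K (j + a)) \<noteq> t" if "0 < a" "a < K" for a
      using arrival_inj[OF cov sites sites, of "j + a" j] that by (simp add: t_def)
    from this[of "K - 1"] this[of 1] show ?thesis using K by (auto simp: t_def)
  qed
  finally show ?thesis by (simp add: t_def)
qed

definition arrives_in_order :: "(nat \<Rightarrow> nat) \<Rightarrow> nat list \<Rightarrow> bool" where
  "arrives_in_order x xs \<longleftrightarrow> sorted_wrt (\<lambda>a b. arrival x a < arrival x b) xs"

lemma precedes_iff_arrival:
  assumes "arrives_in_order x xs" "a \<in> set xs" "b \<in> set xs" "a \<noteq> b"
  shows "precedes xs a b \<longleftrightarrow> arrival x a < arrival x b"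
  using assms unfolding arrives_in_order_def by (induction xs) (auto dest: less_asym)

lemma root_at_iff:
  assumes "K \<ge> 3" "covers K x" "xs \<in> permutations_of_set {1..K}" "arrives_in_order x xs"
  shows "root_at K xs j \<longleftrightarrow> site K j \<in> roots K x"
proof -
  have sites: "site K a \<in> set xs" for a
    using site_in[of K a] assms(1) permutations_of_setD(1)[OF assms(3)] by simp
  have "site K j \<noteq> site K (j + a)" if "0 < a" "a < K" for a
    using inj_onD[OF inj_on_site[of K j], of j "j + a"] that by auto
  from this[of "K - 1"] this[of 1] show ?thesis
    unfolding root_at_def site_in_roots_iff[OF assms(1,2)]
    using precedes_iff_arrival[OF assms(4) sites sites] assms(1) by simp
qed

text \<open>
  Two sites are never hit at the same time, so sorting by arrival times is strict.
\<close>

lemma ex_arrives_in_order: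
  assumes "covers K x"
  shows "\<exists>xs\<in>permutations_of_set {1..K}. arrives_in_order x xs"
proof
  let ?xs = "sort_key (arrival x) [1..<K + 1]"
  have set: "set ?xs = {1..K}" by auto
  have "distinct ?xs" by (simp add: distinct_sort)
  then have "distinct (map (arrival x) ?xs)"
    unfolding distinct_map set using arrival_inj[OF assms] by (auto intro: inj_onI)
  then have "sorted_wrt (<) (map (arrival x) ?xs)"
    by (simp add: strict_sorted_iff)
  then show "arrives_in_order x ?xs"
    by (simp add: arrives_in_order_def sorted_wrt_map)
  show "?xs \<in> permutations_of_set {1..K}"
    using set \<open>distinct ?xs\<close> by (intro permutations_of_setI)
qed

lemma arrives_in_order_unique:
  assumes "covers K x" "xs \<in> permutations_of_set {1..K}" "ys \<in> permutations_of_set {1..K}"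
    "arrives_in_order x xs" "arrives_in_order x ys"
  shows "xs = ys"
proof -
  have sets: "set xs = {1..K}" "set ys = {1..K}" using assms(2,3) permutations_of_setD by auto
  have "map (arrival x) xs = map (arrival x) ys"
    using assms(4,5) sets
    by (intro strict_sorted_equal) (auto simp: arrives_in_order_def sorted_wrt_map)
  then show ?thesis
    using sets arrival_inj[OF assms(1)] by (subst (asm) inj_on_map_eq_map) (auto intro: inj_onI)
qed

text \<open>
  The gap count of a path depends only on the order of first arrivals. The site that is hit first of
  all shows that there is a root.
\<close>

lemma gap_count_eq_gaps:
  assumes "K \<ge> 3" "i + 1 < K" "covers K x" "xs \<in> permutations_of_set {1..K}" "arrives_in_order x xs"
  shows "real (gap_count i K x) = gaps K i xs"
proof -
  have "roots K x \<noteq> {}"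
  proof -
    have fin: "finite {1..K}" "{1..K} \<noteq> {}" using assms(1) by auto
    obtain k where k: "k \<in> {1..K}" "\<And>l. l \<in> {1..K} \<Longrightarrow> arrival x k \<le> arrival x l"
      using ex_min_if_finite[of "arrival x ` {1..K}"] fin by (metis (no_types, lifting) arg_min_least arg_min_if_finite(1))
    have "k - 1 < K" using k(1) by auto
    then have ks: "site K (k - 1) = k" using k(1) by (simp add: site_def)
    have "site K (k - 1 + a) \<noteq> k" if "0 < a" "a < K" for a
      using inj_onD[OF inj_on_site[of K "k - 1"], of "k - 1 + a" "k - 1"] that ks by auto
    then have "arrival x k < arrival x (site K (k - 1 + a))" if "0 < a" "a < K" for a
      using k(2)[of "site K (k - 1 + a)"] arrival_inj[OF assms(3) k(1), of "site K (k - 1 + a)"] site_in[of K "k - 1 + a"] that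
      by (metis gr_implies_not0 le_neq_implies_less neq0_conv)
    from this[of "K - 1"] this[of 1] have "site K (k - 1) \<in> roots K x"
      using assms(1) unfolding site_in_roots_iff[OF assms(1,3)] unfolding ks by simp
    then show ?thesis by auto
  qed
  from gap_count_eq[OF this assms(2)] show ?thesis
    by (simp add: gaps_def gap_at_def root_at_iff[OF assms(1,3-5)])
qed

section \<open>The order of first arrivals is uniformly random\<close>

abbreviation path_space :: "(nat \<Rightarrow> nat) measure" where
  "path_space \<equiv> PiM UNIV (\<lambda>_. count_space UNIV)"

lemma measurable_arrival [measurable]:
  "(\<lambda>x. arrival x k) \<in> measurable path_space (count_space UNIV)"
  unfolding arrival_def by measurable

lemma pred_arrives_in_order [measurable]: "Measurable.pred path_space (\<lambda>x. arrives_in_order x xs)"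
  unfolding arrives_in_order_def
proof (induction xs)
  case (Cons a xs)
  have "Measurable.pred path_space (\<lambda>x. \<forall>b\<in>set xs. arrival x a < arrival x b)"
  proof (intro pred_intros_finite finite_set)
    fix b
    have "(\<lambda>x. arrival x c) \<in> borel_measurable path_space" for c
      by (rule measurable_compose[OF measurable_arrival]) simp
    then show "Measurable.pred path_space (\<lambda>x. arrival x a < arrival x b)" by measurable
  qed
  with Cons show ?case by simp
qed simp

lemma ex_permutes_map:
  assumes "xs \<in> permutations_of_set A" "ys \<in> permutations_of_set A"
  shows "\<exists>\<pi>. \<pi> permutes A \<and> ys = map \<pi> xs"
proof -
  have sets: "set xs = A" "distinct xs" "set ys = A" "distinct ys"
    using assms by (simp_all add: permutations_of_setD)
  then have len: "length xs = length ys" by (metis distinct_card)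
  have bij: "bij_betw ((!) xs) {..<length ys} A" "bij_betw ((!) ys) {..<length ys} A"
    using sets len by (auto intro!: bij_betw_nth)
  define f where "f = inv_into {..<length ys} ((!) xs)"
  define \<pi> where "\<pi> = (\<lambda>a. if a \<in> A then ys ! f a else a)"
  have "bij_betw ((!) ys \<circ> f) A A"
    unfolding f_def using bij_betw_trans[OF bij_betw_inv_into[OF bij(1)] bij(2)] .
  then have "bij_betw \<pi> A A" by (rule bij_betw_cong[THEN iffD1, rotated]) (simp add: \<pi>_def)
  then have "\<pi> permutes A" by (rule bij_imp_permutes) (simp add: \<pi>_def)
  moreover have "ys = map \<pi> xs"
  proof (rule nth_equalityI)
    fix j assume j: "j < length ys"
    then have "f (xs ! j) = j" "xs ! j \<in> A"
      unfolding f_def using bij(1) by (auto simp: bij_betw_def)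
    then show "ys ! j = map \<pi> xs ! j" using j len by (simp add: \<pi>_def)
  qed (simp add: len)
  ultimately show ?thesis by blast
qed

lemma sum_arrival_order:
  fixes f :: "nat list \<Rightarrow> real"
  assumes "covers K x" "ys \<in> permutations_of_set {1..K}" "arrives_in_order x ys"
  shows "(\<Sum>zs\<in>permutations_of_set {1..K}. f zs * of_bool (arrives_in_order x zs)) = f ys"
proof -
  have "(\<Sum>zs\<in>permutations_of_set {1..K}. f zs * of_bool (arrives_in_order x zs)) =
        (\<Sum>zs\<in>permutations_of_set {1..K}. if zs = ys then f ys else 0)"
  proof (rule sum.cong)
    fix zs assume "zs \<in> permutations_of_set {1..K}"
    then have "arrives_in_order x zs \<longleftrightarrow> zs = ys"
      using arrives_in_order_unique[OF assms(1) _ assms(2) _ assms(3)] assms(3) by blast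
    then show "f zs * of_bool (arrives_in_order x zs) = (if zs = ys then f ys else 0)" by simp
  qed simp
  then show ?thesis using assms(2) by simp
qed

context prob_space
begin

lemma iid_uniform_sites_measurable:
  "iid_uniform_sites M K X \<Longrightarrow> X n \<in> measurable M (count_space UNIV)"
  by (auto simp: iid_uniform_sites_def indep_vars_def)

lemma iid_uniform_sites_path_measurable:
  "iid_uniform_sites M K X \<Longrightarrow> (\<lambda>\<omega> n. X n \<omega>) \<in> measurable M path_space"
  by (intro measurable_PiM_single') (auto dest: iid_uniform_sites_measurable)

text \<open>
  The law of the whole path is determined, so it is the same for every independent uniform sequence.
\<close>

lemma iid_uniform_sites_distr:
  assumes "iid_uniform_sites M K X"
  shows "distr M path_space (\<lambda>\<omega> n. X n \<omega>) = PiM UNIV (\<lambda>_. measure_pmf (pmf_of_set {1..K}))"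
proof -
  have "distr M path_space (\<lambda>\<omega>. \<lambda>n\<in>UNIV. X n \<omega>) =
        PiM UNIV (\<lambda>n. distr M (count_space UNIV) (X n))"
    using assms iid_uniform_sites_measurable[OF assms]
    by (subst indep_vars_iff_distr_eq_PiM[symmetric]) (auto simp: iid_uniform_sites_def)
  then show ?thesis using assms by (simp add: iid_uniform_sites_def restrict_UNIV)
qed

lemma iid_uniform_sites_permute:
  assumes "iid_uniform_sites M K X" "K \<ge> 1" "\<pi> permutes {1..K}"
  shows "iid_uniform_sites M K (\<lambda>n \<omega>. \<pi> (X n \<omega>))"
proof -
  have "distr M (count_space UNIV) (\<lambda>\<omega>. \<pi> (X n \<omega>)) = measure_pmf (pmf_of_set {1..K})" for n
  proof -
    have "distr M (count_space UNIV) (\<lambda>\<omega>. \<pi> (X n \<omega>)) =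
          distr (distr M (count_space UNIV) (X n)) (count_space UNIV) \<pi>"
      using iid_uniform_sites_measurable[OF assms(1)] by (subst distr_distr) (auto simp: o_def)
    also have "\<dots> = measure_pmf (map_pmf \<pi> (pmf_of_set {1..K}))"
      using assms(1) by (simp add: iid_uniform_sites_def map_pmf_rep_eq)
    also have "map_pmf \<pi> (pmf_of_set {1..K}) = pmf_of_set {1..K}"
      using assms(2,3) by (subst map_pmf_of_set_inj) (auto simp: permutes_image intro: permutes_inj_on)
    finally show ?thesis .
  qed
  moreover have "indep_vars (\<lambda>_. count_space UNIV) (\<lambda>n \<omega>. \<pi> (X n \<omega>)) UNIV"
    using assms(1) unfolding iid_uniform_sites_def
    by (intro indep_vars_compose2[where X = X and Y = "\<lambda>_. \<pi>" and M' = "\<lambda>_. count_space UNIV"]) auto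
  ultimately show ?thesis by (simp add: iid_uniform_sites_def)
qed

text \<open>
  A given site is missed \<open>N\<close> times in a row with probability \<open>(1 - 1 / K) ^ N\<close>.
\<close>

lemma AE_covers:
  assumes "iid_uniform_sites M K X" "K \<ge> 1"
  shows "AE \<omega> in M. covers K (\<lambda>n. X n \<omega>)"
proof -
  note [measurable] = iid_uniform_sites_measurable[OF assms(1)]
  have "AE \<omega> in M. \<exists>n\<ge>1. X n \<omega> = k" if k: "k \<in> {1..K}" for k
  proof -
    let ?B = "{\<omega> \<in> space M. \<forall>n\<ge>1. X n \<omega> \<noteq> k}"
    have one: "prob (X n -` (- {k}) \<inter> space M) = 1 - 1 / K" for n
    proof -
      have "prob (X n -` (- {k}) \<inter> space M) = measure (distr M (count_space UNIV) (X n)) (- {k})"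
        by (subst measure_distr) auto
      also have "\<dots> = 1 - measure_pmf.prob (pmf_of_set {1..K}) {k}"
        using assms(1) measure_pmf.prob_compl[of "{k}" "pmf_of_set {1..K}"]
        by (simp add: iid_uniform_sites_def Compl_eq_Diff_UNIV)
      also have "measure_pmf.prob (pmf_of_set {1..K}) {k} = 1 / K"
        using k by (simp add: measure_pmf_single)
      finally show ?thesis .
    qed
    have "prob ?B \<le> (1 - 1 / K) ^ N" for N
    proof (cases "N = 0")
      case False
      have "prob ?B \<le> prob (\<Inter>n\<in>{1..N}. X n -` (- {k}) \<inter> space M)"
      proof (rule finite_measure_mono)
        show "(\<Inter>n\<in>{1..N}. X n -` (- {k}) \<inter> space M) \<in> events"
          using False by (intro sets.finite_INT measurable_sets[OF iid_uniform_sites_measurable[OF assms(1)]]) auto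
      qed (use False in auto)
      also have "\<dots> = (\<Prod>n\<in>{1..N}. prob (X n -` (- {k}) \<inter> space M))"
        using assms(1) False unfolding iid_uniform_sites_def by (intro indep_varsD[of _ X UNIV]) auto
      also have "\<dots> = (1 - 1 / K) ^ N" by (simp add: one)
      finally show ?thesis .
    qed simp
    moreover have "(\<lambda>N. (1 - 1 / real K) ^ N) \<longlonglongrightarrow> 0"
      using assms(2) by (intro LIMSEQ_power_zero) (auto simp: abs_if field_simps)
    ultimately have "prob ?B \<le> 0"
      by (intro LIMSEQ_le_const) auto
    then have "prob ?B = 0" by (simp add: measure_le_0_iff)
    then have "AE \<omega> in M. \<omega> \<notin> ?B"
      by (subst prob_eq_0[symmetric]) (auto simp: Collect_conj_eq)
    then show ?thesis by (rule AE_mp) auto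
  qed
  then show ?thesis by (simp add: covers_def AE_ball_countable)
qed

lemma arrival_permute:
  assumes "inj \<pi>"
  shows "arrival (\<lambda>n. \<pi> (x n)) (\<pi> k) = arrival x k"
  using assms by (simp add: arrival_def inj_eq)

text \<open>
  Relabelling the sites by a permutation does not change the law of the path and permutes the possible
  orders of arrival transitively; hence all of them have the same probability. Almost surely exactly
  one of them occurs.
\<close>

lemma prob_arrives_in_order:
  assumes "iid_uniform_sites M K X" "K \<ge> 1" "xs \<in> permutations_of_set {1..K}"
  shows "prob {\<omega> \<in> space M. arrives_in_order (\<lambda>n. X n \<omega>) xs} = 1 / card (permutations_of_set {1..K})"
proof -
  let ?E = "\<lambda>xs. {\<omega> \<in> space M. arrives_in_order (\<lambda>n. X n \<omega>) xs}"
  let ?S = "permutations_of_set {1..K}"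
  have path [measurable]: "(\<lambda>\<omega> n. Y n \<omega>) \<in> measurable M path_space" if "iid_uniform_sites M K Y" for Y
    by (rule iid_uniform_sites_path_measurable[OF that])
  have E: "?E xs \<in> sets M" for xs using path[OF assms(1)] by measurable
  have I: "integrable M (indicator (?E ys) :: 'a \<Rightarrow> real)" for ys
    using E by (intro integrable_real_indicator) (auto simp: emeasure_eq_measure)
  have prob_E: "expectation (indicator (?E ys)) = prob (?E ys)" for ys
    using E by (simp add: Int_absorb2 sets.sets_into_space)
  have law: "prob {\<omega> \<in> space M. arrives_in_order (\<lambda>n. Y n \<omega>) ys} =
     measure (PiM UNIV (\<lambda>_. measure_pmf (pmf_of_set {1..K}))) {x. arrives_in_order x ys}"
    if "iid_uniform_sites M K Y" for Y ys
  proof -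
    have "{x \<in> space path_space. arrives_in_order x ys} \<in> sets path_space" by measurable
    then have "{x. arrives_in_order x ys} \<in> sets path_space" by (simp add: space_PiM)
    then show ?thesis
      unfolding iid_uniform_sites_distr[OF that, symmetric]
      using path[OF that] by (subst measure_distr) (auto intro!: arg_cong[where f = prob])
  qed
  \<comment> \<open>The relabelled path has the same law, and its order of arrival is the relabelled order.\<close>
  have same: "prob (?E ys) = prob (?E xs)" if ys: "ys \<in> ?S" for ys
  proof -
    obtain \<pi> where \<pi>: "\<pi> permutes {1..K}" "ys = map \<pi> xs"
      using ex_permutes_map[OF assms(3) ys] by auto
    have "prob (?E ys) = prob {\<omega> \<in> space M. arrives_in_order (\<lambda>n. \<pi> (X n \<omega>)) ys}"
      using law[OF assms(1)] law[OF iid_uniform_sites_permute[OF assms(1,2) \<pi>(1)]] by simp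
    also have "\<dots> = prob (?E xs)"
      using arrival_permute[OF permutes_inj[OF \<pi>(1)]]
      by (simp add: \<pi>(2) arrives_in_order_def sorted_wrt_map)
    finally show ?thesis .
  qed
  let ?C = "{\<omega> \<in> space M. covers K (\<lambda>n. X n \<omega>)}"
  have C: "AE \<omega> in M. \<omega> \<in> ?C" using AE_covers[OF assms(1,2)] by (rule AE_mp) auto
  have "AE \<omega> in M. (\<Sum>ys\<in>?S. indicator (?E ys) \<omega>) = (1::real)"
  proof (rule AE_mp[OF C], rule AE_I2, rule impI)
    fix \<omega> assume \<omega>: "\<omega> \<in> space M" "\<omega> \<in> ?C"
    then obtain ys where ys: "ys \<in> ?S" "arrives_in_order (\<lambda>n. X n \<omega>) ys"
      using ex_arrives_in_order by auto
    have "(\<Sum>zs\<in>?S. indicator (?E zs) \<omega>) =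
          (\<Sum>zs\<in>?S. (1::real) * of_bool (arrives_in_order (\<lambda>n. X n \<omega>) zs))"
      using \<omega> by (simp add: indicator_def)
    also have "\<dots> = 1" using \<omega> ys by (intro sum_arrival_order) auto
    finally show "(\<Sum>zs\<in>?S. indicator (?E zs) \<omega>) = (1::real)" .
  qed
  then have "expectation (\<lambda>\<omega>. \<Sum>ys\<in>?S. indicator (?E ys) \<omega>) = expectation (\<lambda>_. 1::real)"
    using E by (intro integral_cong_AE) auto
  moreover have "expectation (\<lambda>\<omega>. \<Sum>ys\<in>?S. indicator (?E ys) \<omega>) = (\<Sum>ys\<in>?S. prob (?E ys))"
    by (simp only: prob_E Bochner_Integration.integral_sum[OF I])
  ultimately have "card ?S * prob (?E xs) = 1"
    by (simp add: same prob_space)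
  moreover have "card ?S > 0" using assms(3) by (auto simp: card_gt_0_iff)
  ultimately show ?thesis by (simp add: field_simps)
qed

text \<open>
  Moments of functions of the order of arrival are therefore moments of a uniformly random order.
\<close>

theorem expectation_arrival_order:
  fixes h :: "'a \<Rightarrow> real"
  assumes "iid_uniform_sites M K X" "K \<ge> 1" "h \<in> borel_measurable M"
    and h: "\<And>\<omega> xs. \<omega> \<in> space M \<Longrightarrow> covers K (\<lambda>n. X n \<omega>) \<Longrightarrow> xs \<in> permutations_of_set {1..K} \<Longrightarrow>
              arrives_in_order (\<lambda>n. X n \<omega>) xs \<Longrightarrow> h \<omega> = f xs"
  shows "expectation h = measure_pmf.expectation (random_order {1..K}) f"
proof -
  let ?E = "\<lambda>xs. {\<omega> \<in> space M. arrives_in_order (\<lambda>n. X n \<omega>) xs}"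
  let ?S = "permutations_of_set {1..K}"
  note [measurable] = iid_uniform_sites_path_measurable[OF assms(1)]
  have E: "?E xs \<in> sets M" for xs by measurable
  have I: "integrable M (indicator (?E ys) :: 'a \<Rightarrow> real)" for ys
    using E by (intro integrable_real_indicator) (auto simp: emeasure_eq_measure)
  have prob_E: "expectation (indicator (?E ys)) = prob (?E ys)" for ys
    using E by (simp add: Int_absorb2 sets.sets_into_space)
  have "AE \<omega> in M. h \<omega> = (\<Sum>ys\<in>?S. f ys * indicator (?E ys) \<omega>)"
  proof (rule AE_mp[OF AE_covers[OF assms(1,2)]], rule AE_I2, rule impI)
    fix \<omega> assume \<omega>: "\<omega> \<in> space M" "covers K (\<lambda>n. X n \<omega>)"
    then obtain ys where ys: "ys \<in> ?S" "arrives_in_order (\<lambda>n. X n \<omega>) ys"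
      using ex_arrives_in_order by auto
    have "(\<Sum>zs\<in>?S. f zs * indicator (?E zs) \<omega>) =
          (\<Sum>zs\<in>?S. f zs * of_bool (arrives_in_order (\<lambda>n. X n \<omega>) zs))"
      using \<omega> by (simp add: indicator_def)
    also have "\<dots> = f ys" using \<omega> ys by (intro sum_arrival_order) auto
    also have "\<dots> = h \<omega>" using h[OF \<omega> ys] by simp
    finally show "h \<omega> = (\<Sum>zs\<in>?S. f zs * indicator (?E zs) \<omega>)" by (rule sym)
  qed
  then have "expectation h = expectation (\<lambda>\<omega>. \<Sum>ys\<in>?S. f ys * indicator (?E ys) \<omega>)"
    by (intro integral_cong_AE assms(3) borel_measurable_sum borel_measurable_times
          borel_measurable_const borel_measurable_indicator E)
  also have "\<dots> = (\<Sum>ys\<in>?S. f ys * prob (?E ys))"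
    by (subst Bochner_Integration.integral_sum) (simp_all only: I prob_E integrable_mult_right integral_mult_right_zero)
  also have "\<dots> = (\<Sum>ys\<in>?S. f ys * (1 / card ?S))"
    by (intro sum.cong) (simp_all only: prob_arrives_in_order[OF assms(1,2)])
  also have "\<dots> = (\<Sum>ys\<in>?S. f ys) / card ?S"
    by (simp add: sum_divide_distrib)
  also have "\<dots> = measure_pmf.expectation (random_order {1..K}) f"
    by (simp add: integral_pmf_of_set)
  finally show ?thesis .
qed

section \<open>Moments of the gap counts\<close>

lemma measurable_height:
  assumes "iid_uniform_sites M K X"
  shows "(\<lambda>\<omega>. height K (\<lambda>n. X n \<omega>) n k) \<in> borel_measurable M"
proof (induction n arbitrary: k)
  case (Suc n)
  note [measurable] = iid_uniform_sites_measurable[OF assms] Suc.IH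
  have "\<exists>a b c. nbrs K k = {a, b, c}" by (auto simp: nbrs_def)
  then obtain a b c where nbrs: "nbrs K k = {a, b, c}" by blast
  have "(\<lambda>\<omega>. height K (\<lambda>n. X n \<omega>) (Suc n) k) = (\<lambda>\<omega>. if X (Suc n) \<omega> = k
      then max (height K (\<lambda>n. X n \<omega>) n a) (max (height K (\<lambda>n. X n \<omega>) n b)
             (height K (\<lambda>n. X n \<omega>) n c)) + 1
      else height K (\<lambda>n. X n \<omega>) n k)"
    by (simp add: nbrs fun_eq_iff)
  then show ?case by simp
qed simp

text \<open>
  The gap count is a function of the set of roots, which has finitely many values.
\<close>

lemma measurable_D:
  assumes "iid_uniform_sites M K X"
  shows "D i K X \<in> borel_measurable M"
proof -
  note [measurable] = measurable_height[OF assms]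
  have "(\<lambda>\<omega>. roots K (\<lambda>n. X n \<omega>)) \<in> measurable M (count_space (Pow {1..K}))"
  proof (subst measurable_count_space_eq2, simp, intro conjI ballI)
    fix R assume R: "R \<in> Pow {1..K}"
    have "{k \<in> A. P k} = B \<longleftrightarrow> (\<forall>k\<in>A. P k \<longleftrightarrow> k \<in> B)" if "B \<subseteq> A" for A B :: "nat set" and P
      using that by blast
    then have eq: "roots K x = R \<longleftrightarrow> (\<forall>k\<in>{1..K}. (\<exists>n\<ge>1. height K x n k = 1) \<longleftrightarrow> k \<in> R)" for x
      unfolding roots_def using R by blast
    have "(\<lambda>\<omega>. roots K (\<lambda>n. X n \<omega>)) -` {R} \<inter> space M = {\<omega> \<in> space M. roots K (\<lambda>n. X n \<omega>) = R}"
      by auto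
    also have "\<dots> = {\<omega> \<in> space M. \<forall>k\<in>{1..K}. (\<exists>n\<ge>1. height K (\<lambda>n. X n \<omega>) n k = 1) \<longleftrightarrow> k \<in> R}"
      by (simp only: eq)
    also have "\<dots> \<in> sets M" by measurable
    finally show "(\<lambda>\<omega>. roots K (\<lambda>n. X n \<omega>)) -` {R} \<inter> space M \<in> sets M" .
  qed (auto simp: roots_def)
  then show ?thesis
    unfolding D_def gap_count_def num_roots_def root_loc_def
    by (rule measurable_compose) simp
qed

lemma D_moments:
  assumes "iid_uniform_sites M K X" "1 \<le> i" "2 * i + 7 \<le> K"
  shows "expectation (D i K X) = real K * gap_prob i"
    and "variance (D i K X) = real K * (gap_prob i + 2 * adjacent_gaps_prob i +
           2 * separated_gaps_prob i - (2 * real i + 7) * (gap_prob i)\<^sup>2)"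
proof -
  have D: "D i K X \<omega> = gaps K i xs"
    if "covers K (\<lambda>n. X n \<omega>)" "xs \<in> permutations_of_set {1..K}" "arrives_in_order (\<lambda>n. X n \<omega>) xs"
    for \<omega> xs
    unfolding D_def using assms that by (intro gap_count_eq_gaps) auto
  note [measurable] = measurable_D[OF assms(1)]
  have e: "expectation (D i K X) = measure_pmf.expectation (random_order {1..K}) (gaps K i)"
    using assms D by (intro expectation_arrival_order) auto
  then show "expectation (D i K X) = real K * gap_prob i"
    using expectation_gaps[of i K] assms by simp
  have "variance (D i K X) = measure_pmf.variance (random_order {1..K}) (gaps K i)"
    unfolding e using assms D by (intro expectation_arrival_order) auto
  then show "variance (D i K X) = real K * (gap_prob i + 2 * adjacent_gaps_prob i +
           2 * separated_gaps_prob i - (2 * real i + 7) * (gap_prob i)\<^sup>2)"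
    using variance_gaps[of i K] assms by simp
qed

end

theorem theorem5:
  fixes M :: "'a measure" and X :: "nat \<Rightarrow> 'a \<Rightarrow> nat" and K :: nat
  assumes "prob_space M"
    and "K \<ge> 31"
    and "iid_uniform_sites M K X"
  shows "prob_space.expectation M (D 2 K X) = real K / 9 \<and>
         prob_space.expectation M (D 3 K X) = 2 * real K / 35 \<and>
         prob_space.expectation M (D 4 K X) = real K / 45 \<and>
         prob_space.expectation M (D 5 K X) = 4 * real K / 567 \<and>
         prob_space.expectation M (D 6 K X) = real K / 525 \<and>
         prob_space.expectation M (D 7 K X) = 2 * real K / 4455 \<and>
         prob_space.variance M (D 2 K X) = 32 * real K / 405 \<and>
         prob_space.variance M (D 3 K X) = 119732 * real K / 2837835 \<and>
         prob_space.variance M (D 4 K X) = 12154 * real K / 637875 \<and>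
         prob_space.variance M (D 5 K X) = 649555688 * real K / 97692469875 \<and>
         prob_space.variance M (D 6 K X) = 5967328 * real K / 3192564375 \<and>
         prob_space.variance M (D 7 K X) = 191501338988 * real K / 428772250281375"
proof -
  note moments = prob_space.D_moments[OF assms(1,3)]
  note probs = gap_prob_def adjacent_gaps_prob_def separated_gaps_prob_def
    gap_values adjacent_gaps_values separated_gaps_values
  have E: "prob_space.expectation M (D i K X) = real K * gap_prob i" if "i \<in> {2..7}" for i
    using that assms(2) by (intro moments) auto
  have V: "prob_space.variance M (D i K X) = real K * (gap_prob i + 2 * adjacent_gaps_prob i +
           2 * separated_gaps_prob i - (2 * real i + 7) * (gap_prob i)\<^sup>2)" if "i \<in> {2..7}" for i
    using that assms(2) by (intro moments) auto
  show ?thesis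
    by (intro conjI) (subst E V, simp, simp add: probs power2_eq_square del: One_nat_def)+
qed

end
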